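(* Consider a linear finite-field deterministic network on a directed acyclic graph $\mathcal{G}=(\mathcal{V},\mathcal{E})$ with $\mathcal{V}=\{1,\ldots,N,d\}$, in which each of the nodes $1,\ldots,N$ has an independent message for the single destination $d$. The capacity region $\mathcal{C}$ of this network is the set of all rate tuples $(R_1,\ldots,R_N)$ of non-negative reals satisfying \[ \sum_{i\in\mathcal{S}} R_i \le \operatorname{rank}\{\mathbf{G}_{\mathcal{S},\mathcal{S}^c}\} \quad \text{for all } \mathcal{S}\subseteq\{1,\ldots,N\}, \] where $\mathcal{S}^c=\mathcal{V}\setminus\mathcal{S}$ and the rank is taken over $\mathbb{F}_2$.
   Context: Network model: fix an integer $q\ge 1$ and integers $0\le n_{i,j}\le q$ for each edge $(i,j)\in\mathcal{E}$. At each discrete time, every node $i$ transmits a vector $\mathbf{x}_i\in\mathbb{F}_2^q$, and every node $j$ receives $\mathbf{y}_j=\sum_{i:(i,j)\in\mathcal{E}} \mathbf{S}^{q-n_{i,j}}\mathbf{x}_i\in\mathbb{F}_2^q$ (arithmetic over $\mathbb{F}_2$), where $\mathbf{S}$ is the $q\times q$ down-shift matrix (ones on the first subdiagonal, zeros elsewhere). Thus the input $\mathbf{x}_i$ is common to all outgoing edges of $i$ (broadcast) and received signals superimpose (interference). Cut transfer matrix: for $i\in\mathcal{V}$ let $\mathcal{N}(i)=\{j:(i,j)\in\mathcal{E}\}$ and $\mathcal{P}(j)=\{i:(i,j)\in\mathcal{E}\}$. For $\mathcal{S}\subseteq\mathcal{V}$ with complement $\mathcal{S}^c$, let $\beta_{\rm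 in}(\mathcal{S})=\{i\in\mathcal{S}:\mathcal{N}(i)\cap\mathcal{S}^c\ne\emptyset\}$ and $\beta_{\rm out}(\mathcal{S})=\{j\in\mathcal{S}^c:\mathcal{P}(j)\cap\mathcal{S}\ne\emptyset\}$. $\mathbf{G}_{\mathcal{S},\mathcal{S}^c}$ is the matrix over $\mathbb{F}_2$ of the linear map from the stacked inputs $(\mathbf{x}_i)_{i\in\beta_{\rm in}(\mathcal{S})}$ to the stacked outputs $(\mathbf{y}_j)_{j\in\beta_{\rm out}(\mathcal{S})}$ (contributions from nodes outside $\mathcal{S}$ ignored), i.e. the block matrix whose $(j,i)$ block is $\mathbf{S}^{q-n_{i,j}}$ if $(i,j)\in\mathcal{E}$ and $0$ otherwise (empty matrix, rank $0$, if there are no such nodes). Codes and capacity: for an integer $T\ge1$, node $i\in\{1,\ldots,N\}$ has message set $\mathcal{W}_i=\{1,\ldots,\lceil 2^{TR_i}\rceil\}$. A $(T,R_1,\ldots,R_N)$ code consists of strictly causal encoders $f_i^{[t]}:\mathcal{W}_i\times\mathbb{F}_2^{q(t-1)}\to\mathbb{F}_2^q$, $t=1,\ldots,T$, with $\mathbf{x}_i[t]=f_i^{[t]}(w_i,\mathbf{y}_i[1],\ldots,\mathbf{y}_i[t-1])$, and a decoder $g:\mathbb{F}_2^{Tq}\to\mathcal{W}_1\times\cdots\times\mathcal{W}_N$ applied to $(\mathbf{y}_d[1],\ldots,\mathbf{y}_d[T])$. With messages $W_i$ independent and uniform on $\mathcal{W}_i$, the error probability is the probability that the decoded tuple differs from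 $(W_1,\ldots,W_N)$. A rate tuple is achievable if there is a sequence of such codes with error probability tending to $0$ as $T\to\infty$; the capacity region is the closure of the set of achievable rate tuples. *)

theory Defs
  imports "HOL-Analysis.Analysis" "HOL-Library.Z2" "Jordan_Normal_Form.DL_Rank"
begin

(* Vectors of F_2^q are represented as functions nat => bool (coordinate k, 0-indexed,
   True = 1); only coordinates k < q are meaningful.  Received signals are always zero
   at coordinates >= q. *)

(* received signal at node j when node i transmits x i:
   y_j = sum_{i : (i,j) in E} S^(q - n(i,j)) x_i over F_2.
   (S^m x)_k = x_(k-m) if m <= k < q, else 0;  sum over F_2 = parity. *)
definition recv :: "nat \<Rightarrow> (nat \<times> nat) set \<Rightarrow> (nat \<times> nat \<Rightarrow> nat) \<Rightarrow> nat
                    \<Rightarrow> (nat \<Rightarrow> nat \<Rightarrow> bool) \<Rightarrow> (nat \<Rightarrow> bool)" where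
  "recv q E n j x = (\<lambda>k. odd (card {i. (i, j) \<in> E \<and> k < q \<and> q - n (i, j) \<le> k
                                         \<and> x i (k - (q - n (i, j)))}))"

(* Encoders: f i t w ys = x_i[t] computed from the message w of node i and the list
   ys = [y_i[1],...,y_i[t-1]] of previously received signals (strict causality).
   rx q E n f w t i = [y_i[1], ..., y_i[t]]. *)
fun rx :: "nat \<Rightarrow> (nat \<times> nat) set \<Rightarrow> (nat \<times> nat \<Rightarrow> nat)
           \<Rightarrow> (nat \<Rightarrow> nat \<Rightarrow> nat \<Rightarrow> (nat \<Rightarrow> bool) list \<Rightarrow> (nat \<Rightarrow> bool))
           \<Rightarrow> (nat \<Rightarrow> nat) \<Rightarrow> nat \<Rightarrow> nat \<Rightarrow> (nat \<Rightarrow> bool) list" where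
  "rx q E n f w 0 = (\<lambda>j. [])"
| "rx q E n f w (Suc t) =
     (\<lambda>j. rx q E n f w t j @
          [recv q E n j (\<lambda>i. f i (Suc t) (w i) (rx q E n f w t i))])"

definition nmsg :: "nat \<Rightarrow> real \<Rightarrow> nat" where
  "nmsg T r = nat \<lceil>2 powr (real T * r)\<rceil>"

definition msgs :: "nat \<Rightarrow> nat \<Rightarrow> (nat \<Rightarrow> real) \<Rightarrow> (nat \<Rightarrow> nat) set" where
  "msgs N T R = {w. (\<forall>i\<in>{1..N}. w i \<in> {1..nmsg T (R i)}) \<and> (\<forall>i. i \<notin> {1..N} \<longrightarrow> w i = 0)}"

definition err_prob :: "nat \<Rightarrow> (nat \<times> nat) set \<Rightarrow> (nat \<times> nat \<Rightarrow> nat) \<Rightarrow> nat \<Rightarrow> nat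
     \<Rightarrow> nat \<Rightarrow> (nat \<Rightarrow> real)
     \<Rightarrow> (nat \<Rightarrow> nat \<Rightarrow> nat \<Rightarrow> (nat \<Rightarrow> bool) list \<Rightarrow> (nat \<Rightarrow> bool))
     \<Rightarrow> ((nat \<Rightarrow> bool) list \<Rightarrow> (nat \<Rightarrow> nat)) \<Rightarrow> real" where
  "err_prob q E n N d T R f g =
     real (card {w \<in> msgs N T R. \<exists>i\<in>{1..N}. g (rx q E n f w T d) i \<noteq> w i})
     / real (card (msgs N T R))"

definition rate_tuples :: "nat \<Rightarrow> (nat \<Rightarrow> real) set" where
  "rate_tuples N = {R. \<forall>i. i \<notin> {1..N} \<longrightarrow> R i = 0}"

definition achievable :: "nat \<Rightarrow> (nat \<times> nat) set \<Rightarrow> (nat \<times> nat \<Rightarrow> nat) \<Rightarrow> nat \<Rightarrow> nat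
                          \<Rightarrow> (nat \<Rightarrow> real) \<Rightarrow> bool" where
  "achievable q E n N d R \<longleftrightarrow> R \<in> rate_tuples N \<and> (\<forall>i\<in>{1..N}. 0 \<le> R i) \<and>
     (\<exists>f g. (\<lambda>T. err_prob q E n N d T R (f T) (g T)) \<longlonglongrightarrow> 0)"

definition capacity_region :: "nat \<Rightarrow> (nat \<times> nat) set \<Rightarrow> (nat \<times> nat \<Rightarrow> nat) \<Rightarrow> nat \<Rightarrow> nat
                               \<Rightarrow> (nat \<Rightarrow> real) set" where
  "capacity_region q E n N d = closure {R. achievable q E n N d R}"

definition beta_in :: "(nat \<times> nat) set \<Rightarrow> nat set \<Rightarrow> nat set \<Rightarrow> nat set" where
  "beta_in E V S = {i \<in> S. \<exists>j. (i, j) \<in> E \<and> j \<in> V - S}"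

definition beta_out :: "(nat \<times> nat) set \<Rightarrow> nat set \<Rightarrow> nat set \<Rightarrow> nat set" where
  "beta_out E V S = {j \<in> V - S. \<exists>i. (i, j) \<in> E \<and> i \<in> S}"

(* shift power S^m: entry (a,b) (0-indexed) is 1 iff a = b + m *)
definition cut_matrix :: "nat \<Rightarrow> (nat \<times> nat) set \<Rightarrow> (nat \<times> nat \<Rightarrow> nat) \<Rightarrow> nat set
                          \<Rightarrow> nat set \<Rightarrow> bit mat" where
  "cut_matrix q E n V S =
     (let ins = sorted_list_of_set (beta_in E V S);
          outs = sorted_list_of_set (beta_out E V S)
      in mat (q * length outs) (q * length ins)
           (\<lambda>(r, c). let j = outs ! (r div q); a = r mod q;
                         i = ins ! (c div q); b = c mod q
                     in if (i, j) \<in> E \<and> a = b + (q - n (i, j)) then 1 else 0))"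

definition cut_rank :: "nat \<Rightarrow> (nat \<times> nat) set \<Rightarrow> (nat \<times> nat \<Rightarrow> nat) \<Rightarrow> nat set
                        \<Rightarrow> nat set \<Rightarrow> nat" where
  "cut_rank q E n V S = vec_space.rank (dim_row (cut_matrix q E n V S)) (cut_matrix q E n V S)"

end

theory Submission
  imports Defs
begin

text \<open>
  Over the two-element field the set of signals that can cross a cut has exactly
  \<open>2 ^ rank\<close> elements.

  Converse: once the messages outside \<open>S\<close> are fixed, everything received outside \<open>S\<close> during
  \<open>T\<close> steps is determined by the \<open>T\<close> signals crossing the cut, so at most
  \<open>2 ^ (rank * T)\<close> of the message tuples of \<open>S\<close> can be decoded correctly.

  Achievability: let every node, at every time, apply a fresh random function to its message and
  its whole reception history. For two message tuples let \<open>D\<close> be the set of nodes whose message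
  or history differs. The set \<open>D\<close> only grows, and it fails to grow in a given step with
  probability at most \<open>2 ^ - rank D\<close>, because the signal difference crossing the cut of \<open>D\<close> is
  uniform on its range. As \<open>D\<close> can grow only \<open>N\<close> times before it contains \<open>d\<close>, a pair differing on
  \<open>S\<close> stays indistinguishable at \<open>d\<close> with probability about \<open>2 ^ - (T * min rank A)\<close>, the
  minimum being over \<open>A \<supseteq> S\<close>, and a union bound over the pairs suffices for rates strictly inside
  the region. The random choice is derandomised one step at a time with the potential
  \<open>K ^ card (V - D) * l ^ (T - t)\<close> of the pairs not yet told apart by \<open>d\<close>.
\<close>

section \<open>The range of a matrix over the two-element field\<close>

text \<open>Coordinates with respect to a finite basis identify the vectors with the scalar-valued
  functions on that basis.\<close>

lemma (in vectorspace) card_carrier_eq_power_dim: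
  assumes "fin_dim"
  shows "card (carrier V) = card (carrier K) ^ dim"
proof -
  obtain A where A: "finite A" "basis A"
    using finite_basis_exists[OF assms] by blast
  have AV: "A \<subseteq> carrier V"
    using A(2) unfolding basis_def by simp
  have uniq: "\<exists>!a. a \<in> A \<rightarrow>\<^sub>E carrier K \<and> lincomb a A = v" if "v \<in> carrier V" for v
    using basis_criterion[OF A(1) AV] A(2) that by blast
  have closed: "lincomb a A \<in> carrier V" if "a \<in> A \<rightarrow>\<^sub>E carrier K" for a
    using lincomb_closed[OF AV] that by (auto simp: PiE_def)
  have "bij_betw (\<lambda>a. lincomb a A) (A \<rightarrow>\<^sub>E carrier K) (carrier V)"
    unfolding bij_betw_def
  proof
    show "inj_on (\<lambda>a. lincomb a A) (A \<rightarrow>\<^sub>E carrier K)"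
      using uniq closed by (intro inj_onI) metis
    show "(\<lambda>a. lincomb a A) ` (A \<rightarrow>\<^sub>E carrier K) = carrier V"
      using uniq closed by blast
  qed
  from bij_betw_same_card[OF this] show ?thesis
    using A by (simp add: card_PiE dim_basis)
qed

text \<open>The range is the column space, its dimension is the rank, and the scalar field has two
  elements.\<close>

lemma card_range_mult_mat_vec_bit:
  fixes A :: "bit mat"
  shows "card {A *\<^sub>v v | v. v \<in> carrier_vec (dim_col A)} = 2 ^ vec_space.rank (dim_row A) A"
proof -
  define m where "m = dim_row A"
  interpret vec_space "TYPE(bit)" m .
  have A: "A \<in> carrier_mat m (dim_col A)"
    by (auto simp: m_def)
  have sub: "set (cols A) \<subseteq> carrier_vec m"
    using cols_dim[of A] m_def by simp
  interpret W: vectorspace class_ring "span_vs (set (cols A))"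
    using span_is_subspace[OF sub] subspace_is_vs by blast
  have fd: "W.fin_dim"
    using fin_dim_span_cols[OF A] .
  have "card (carrier (span_vs (set (cols A)))) = card (carrier (class_ring :: bit ring)) ^ W.dim"
    by (rule W.card_carrier_eq_power_dim[OF fd])
  moreover have "card (carrier (class_ring :: bit ring)) = 2"
  proof -
    have "(UNIV :: bit set) = {0, 1}"
      using bit_not_one_iff by blast
    then have "card (UNIV :: bit set) = 2"
      by (metis card_2_iff zero_neq_one)
    then show ?thesis
      by (simp add: class_ring_simps)
  qed
  moreover have "carrier (span_vs (set (cols A))) = {A *\<^sub>v v | v. v \<in> carrier_vec (dim_col A)}"
  proof -
    have "carrier (span_vs (set (cols A))) = span (set (cols A))"
      by simp
    also have "\<dots> = {y \<in> carrier_vec m. \<exists>v\<in>carrier_vec (dim_col A). A *\<^sub>v v = y}"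
      using col_space_eq[OF A] unfolding col_space_def by (simp only: m_def)
    also have "\<dots> = {A *\<^sub>v v | v. v \<in> carrier_vec (dim_col A)}"
      using mult_mat_vec_carrier[OF A] by blast
    finally show ?thesis .
  qed
  ultimately have "card {A *\<^sub>v v | v. v \<in> carrier_vec (dim_col A)} = 2 ^ rank A"
    by (simp only: rank_def)
  then show ?thesis
    by (simp only: m_def)
qed

section \<open>Signals crossing a cut and the rank of its transfer matrix\<close>

text \<open>Links the two forms of addition over the two-element field: matrix products sum in
  \<open>bit\<close>, whereas \<open>recv\<close> takes the parity of a cardinality.\<close>

lemma sum_of_bool_bit:
  assumes "finite A"
  shows "(\<Sum>x\<in>A. of_bool (P x) :: bit) = of_bool (odd (card {x \<in> A. P x}))"
proof -
  have "(\<Sum>x\<in>A. of_bool (P x) :: bit) = of_nat (card {x \<in> A. P x})"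
    using assms by (simp add: sum.If_cases of_bool_def Int_def)
  moreover have "of_nat k = (of_bool (odd k) :: bit)" for k
    by (induction k) auto
  ultimately show ?thesis by simp
qed

text \<open>The linear map of the cut matrix, without any indexing of rows and columns: inputs
  outside \<open>S\<close> are replaced by zero, and outputs outside \<open>V - S\<close> are set to
  zero, so that both sides are total functions.\<close>

definition cut_output ::
  "nat \<Rightarrow> (nat \<times> nat) set \<Rightarrow> (nat \<times> nat \<Rightarrow> nat) \<Rightarrow> nat set \<Rightarrow> nat set
    \<Rightarrow> (nat \<Rightarrow> nat \<Rightarrow> bool) \<Rightarrow> (nat \<Rightarrow> nat \<Rightarrow> bool)" where
  "cut_output q E n V S x = (\<lambda>j k. j \<in> V - S \<and> recv q E n j (\<lambda>i k. i \<in> S \<and> x i k) k)"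

lemma recv_bound: "recv q E n j x k \<Longrightarrow> k < q"
  unfolding recv_def by (cases "k < q") auto

lemma cut_output_support:
  assumes "cut_output q E n V S x j k"
  shows "j \<in> beta_out E V S" "k < q"
proof -
  have "j \<in> V - S" and r: "recv q E n j (\<lambda>i k. i \<in> S \<and> x i k) k"
    using assms by (auto simp: cut_output_def)
  moreover have "{i. (i, j) \<in> E \<and> k < q \<and> q - n (i, j) \<le> k \<and> i \<in> S \<and> x i (k - (q - n (i, j)))} \<noteq> {}"
    using r unfolding recv_def by (metis card.empty even_zero)
  ultimately show "j \<in> beta_out E V S"
    by (auto simp: beta_out_def)
  show "k < q"
    using r by (rule recv_bound)
qed

text \<open>Flattening inputs by \<open>inp\<close> and outputs by \<open>enc\<close> turns
  \<open>cut_output\<close> into multiplication by the cut matrix. As \<open>inp\<close> is onto and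
  \<open>enc\<close> is injective on the range, the two ranges have the same size.\<close>

lemma card_range_cut_output:
  assumes "q \<ge> 1" "finite V" "S \<subseteq> V"
  shows "card (range (cut_output q E n V S)) = 2 ^ cut_rank q E n V S"
proof -
  define ins where "ins = sorted_list_of_set (beta_in E V S)"
  define outs where "outs = sorted_list_of_set (beta_out E V S)"
  define A where "A = cut_matrix q E n V S"
  define enc :: "(nat \<Rightarrow> nat \<Rightarrow> bool) \<Rightarrow> bit vec" where
    "enc y = vec (q * length outs) (\<lambda>r. of_bool (y (outs ! (r div q)) (r mod q)))" for y
  define inp :: "(nat \<Rightarrow> nat \<Rightarrow> bool) \<Rightarrow> bit vec" where
    "inp x = vec (q * length ins) (\<lambda>c. of_bool (x (ins ! (c div q)) (c mod q)))" for x
  have fin: "finite (beta_in E V S)" "finite (beta_out E V S)"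
    using assms(2) finite_subset[OF assms(3,2)] by (auto simp: beta_in_def beta_out_def)
  have ins: "set ins = beta_in E V S" "distinct ins"
    and outs: "set outs = beta_out E V S" "distinct outs"
    using fin by (auto simp: ins_def outs_def)
  have dim: "dim_row A = q * length outs" "dim_col A = q * length ins"
    unfolding A_def cut_matrix_def Let_def ins_def outs_def by simp_all
  have divlt: "r div q < l" if "r < q * l" for r l :: nat
    using that by (simp add: less_mult_imp_div_less mult.commute)
  \<comment> \<open>Index \<open>p * q + b\<close> addresses coordinate \<open>b\<close> of the
    \<open>p\<close>-th node in the list.\<close>
  have block: "p * q + b < q * l" "(p * q + b) div q = p" "(p * q + b) mod q = b"
    if "p < l" "b < q" for p b l :: nat
  proof -
    have "p * q + b < (p + 1) * q" using that by simp
    also have "\<dots> \<le> l * q" using that by (intro mult_right_mono) auto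
    finally show "p * q + b < q * l" by (simp add: mult.commute)
    show "(p * q + b) div q = p" "(p * q + b) mod q = b" using that by auto
  qed
  have entry: "A $$ (r, c) = of_bool ((ins ! (c div q), outs ! (r div q)) \<in> E \<and>
      r mod q = c mod q + (q - n (ins ! (c div q), outs ! (r div q))))"
    if "r < q * length outs" "c < q * length ins" for r c
    using that unfolding A_def cut_matrix_def Let_def ins_def[symmetric] outs_def[symmetric]
    by simp
  have mult: "A *\<^sub>v inp x = enc (cut_output q E n V S x)" for x
  proof (rule eq_vecI)
    show "dim_vec (A *\<^sub>v inp x) = dim_vec (enc (cut_output q E n V S x))"
      by (simp add: dim enc_def)
    fix r assume "r < dim_vec (enc (cut_output q E n V S x))"
    then have r: "r < q * length outs" by (simp add: enc_def)
    define j where "j = outs ! (r div q)"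
    define a where "a = r mod q"
    have jb: "j \<in> beta_out E V S"
      using divlt[OF r] outs(1) unfolding j_def by (metis nth_mem)
    then have jV: "j \<in> V - S" by (simp add: beta_out_def)
    have aq: "a < q" using assms(1) by (simp add: a_def)
    define B where "B = {c \<in> {0..<q * length ins}. (ins ! (c div q), j) \<in> E \<and>
      a = c mod q + (q - n (ins ! (c div q), j)) \<and> x (ins ! (c div q)) (c mod q)}"
    define C where "C = {i. (i, j) \<in> E \<and> a < q \<and> q - n (i, j) \<le> a \<and>
      i \<in> S \<and> x i (a - (q - n (i, j)))}"
    have "(A *\<^sub>v inp x) $ r = (\<Sum>c\<in>{0..<q * length ins}. A $$ (r, c) * inp x $ c)"
      using r by (simp add: dim scalar_prod_def inp_def)
    also have "\<dots> = (\<Sum>c\<in>{0..<q * length ins}. of_bool ((ins ! (c div q), j) \<in> E \<and>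
      a = c mod q + (q - n (ins ! (c div q), j)) \<and> x (ins ! (c div q)) (c mod q)))"
      by (rule sum.cong) (use r in \<open>auto simp: entry inp_def j_def a_def\<close>)
    also have "\<dots> = of_bool (odd (card B))"
      unfolding B_def by (rule sum_of_bool_bit) simp
    \<comment> \<open>Each transmitter \<open>i\<close> in \<open>C\<close> meets row
      \<open>r\<close> in exactly one column, coordinate \<open>a - (q - n (i, j))\<close> of its
      block, so counting columns is counting transmitters.\<close>
    also have "card B = card C"
    proof (rule bij_betw_same_card)
      show "bij_betw (\<lambda>c. ins ! (c div q)) B C"
        unfolding bij_betw_def
      proof
        show "inj_on (\<lambda>c. ins ! (c div q)) B"
        proof (rule inj_onI)
          fix c c' assume c: "c \<in> B" "c' \<in> B" and eq: "ins ! (c div q) = ins ! (c' div q)"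
          then have "c div q = c' div q"
            using ins(2) divlt by (simp add: B_def nth_eq_iff_index_eq)
          moreover have "c mod q = c' mod q"
            using c eq unfolding B_def by simp
          ultimately show "c = c'"
            by (metis div_mult_mod_eq)
        qed
        show "(\<lambda>c. ins ! (c div q)) ` B = C"
        proof (intro equalityI subsetI)
          fix i assume "i \<in> (\<lambda>c. ins ! (c div q)) ` B"
          then obtain c where c: "c \<in> B" "i = ins ! (c div q)" by auto
          then have "c div q < length ins" using divlt by (simp add: B_def)
          then have "i \<in> beta_in E V S" using c(2) ins(1) nth_mem by metis
          then show "i \<in> C"
            using c aq by (auto simp: B_def C_def beta_in_def)
        next
          fix i assume i: "i \<in> C"
          then have "i \<in> set ins"
            using jV ins(1) by (auto simp: C_def beta_in_def)
          then obtain p where p: "p < length ins" "ins ! p = i"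
            by (auto simp: in_set_conv_nth)
          define b where "b = a - (q - n (i, j))"
          have b: "b < q" "a = b + (q - n (i, j))"
            using i aq by (auto simp: b_def C_def)
          have "p * q + b \<in> B"
            using i p b block[OF p(1) b(1)] by (auto simp: B_def C_def)
          then show "i \<in> (\<lambda>c. ins ! (c div q)) ` B"
            using block[OF p(1) b(1)] p(2) by (intro image_eqI[of _ _ "p * q + b"]) auto
        qed
      qed
    qed
    also have "of_bool (odd (card C)) = enc (cut_output q E n V S x) $ r"
      using r jV by (simp add: enc_def cut_output_def recv_def C_def j_def a_def)
    finally show "(A *\<^sub>v inp x) $ r = enc (cut_output q E n V S x) $ r" .
  qed
  have surj: "v \<in> range inp" if "v \<in> carrier_vec (q * length ins)" for v
  proof -
    define x where "x i b = (\<exists>p<length ins. ins ! p = i \<and> v $ (p * q + b) = 1)" for i b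
    have "inp x = v"
    proof (rule eq_vecI)
      show "dim_vec (inp x) = dim_vec v" using that by (simp add: inp_def)
      fix c assume "c < dim_vec v"
      then have c: "c < q * length ins" using that by simp
      have "x (ins ! (c div q)) (c mod q) \<longleftrightarrow> v $ c = 1"
        unfolding x_def using divlt[OF c] ins(2) by (auto simp: nth_eq_iff_index_eq)
      then show "inp x $ c = v $ c"
        using c by (cases "v $ c = 1") (auto simp: inp_def)
    qed
    then show ?thesis by blast
  qed
  have "{A *\<^sub>v v | v. v \<in> carrier_vec (dim_col A)} = enc ` range (cut_output q E n V S)"
  proof -
    have "carrier_vec (dim_col A) = range inp"
      using surj by (auto simp: dim inp_def)
    then have "{A *\<^sub>v v | v. v \<in> carrier_vec (dim_col A)} = (\<lambda>x. A *\<^sub>v inp x) ` UNIV"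
      by auto
    then show ?thesis
      unfolding mult by (simp add: image_image)
  qed
  \<comment> \<open>\<open>enc\<close> keeps only the coordinates below \<open>q\<close> of nodes in
    \<open>beta_out E V S\<close>; everywhere else a cut output vanishes.\<close>
  moreover have "inj_on enc (range (cut_output q E n V S))"
  proof (rule inj_onI)
    fix y y' assume y: "y \<in> range (cut_output q E n V S)" "y' \<in> range (cut_output q E n V S)"
      and eq: "enc y = enc y'"
    have "y j k = y' j k" for j k
    proof (cases "j \<in> beta_out E V S \<and> k < q")
      case True
      then obtain p where p: "p < length outs" "outs ! p = j"
        using outs(1) by (metis in_set_conv_nth)
      have "enc y $ (p * q + k) = enc y' $ (p * q + k)" using eq by simp
      then show ?thesis
        using block[OF p(1)] p True by (simp add: enc_def of_bool_def split: if_splits)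
    next
      case False
      then show ?thesis using y cut_output_support by blast
    qed
    then show "y = y'" by blast
  qed
  ultimately have "card (range (cut_output q E n V S))
      = card {A *\<^sub>v v | v. v \<in> carrier_vec (dim_col A)}"
    by (simp add: card_image)
  also have "\<dots> = 2 ^ cut_rank q E n V S"
    unfolding cut_rank_def A_def[symmetric] by (rule card_range_mult_mat_vec_bit)
  finally show ?thesis .
qed

section \<open>Additivity of reception\<close>

lemma recv_cong:
  assumes "\<And>i. (i, j) \<in> E \<Longrightarrow> x i = x' i"
  shows "recv q E n j x = recv q E n j x'"
  unfolding recv_def using assms by (intro ext arg_cong[where f = "\<lambda>A. odd (card A)"]) auto

lemma odd_card_sym_diff:
  assumes "finite A" "finite B"
  shows "odd (card ((A - B) \<union> (B - A))) \<longleftrightarrow> odd (card A) \<noteq> odd (card B)"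
proof -
  have "card ((A - B) \<union> (B - A)) = card (A - B) + card (B - A)"
    using assms by (intro card_Un_disjoint) auto
  moreover have "card A = card (A - B) + card (A \<inter> B)" "card B = card (B - A) + card (A \<inter> B)"
    using assms by (metis card_Int_Diff add.commute, metis card_Int_Diff Int_commute add.commute)
  ultimately show ?thesis by auto
qed

text \<open>The transmitters contributing a one under the sum of two inputs form the symmetric
  difference of those contributing under each.\<close>

lemma recv_xor:
  assumes "finite E"
  shows "recv q E n j (\<lambda>i k. x i k \<noteq> x' i k) k \<longleftrightarrow> recv q E n j x k \<noteq> recv q E n j x' k"
proof -
  define A where "A z = {i. (i, j) \<in> E \<and> k < q \<and> q - n (i, j) \<le> k \<and> z i (k - (q - n (i, j)))}"
    for z :: "nat \<Rightarrow> nat \<Rightarrow> bool"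
  have fin: "finite (A z)" for z
    by (rule finite_subset[OF _ finite_imageI[OF assms, of fst]]) (force simp: A_def)
  have recv: "recv q E n j z k = odd (card (A z))" for z
    by (simp add: recv_def A_def)
  have "A (\<lambda>i k. x i k \<noteq> x' i k) = (A x - A x') \<union> (A x' - A x)"
    by (auto simp: A_def)
  then show ?thesis
    unfolding recv by (simp only: odd_card_sym_diff[OF fin fin])
qed

section \<open>Counting message tuples\<close>

text \<open>The product \<open>PiE A B\<close>, but with the default value \<open>0\<close> outside
  \<open>A\<close> that \<open>msgs\<close> uses.\<close>

definition choices :: "'a set \<Rightarrow> ('a \<Rightarrow> nat set) \<Rightarrow> ('a \<Rightarrow> nat) set" where
  "choices A B = {w. (\<forall>i\<in>A. w i \<in> B i) \<and> (\<forall>i. i \<notin> A \<longrightarrow> w i = 0)}"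

lemma bij_betw_choices: "bij_betw (\<lambda>w. restrict w A) (choices A B) (PiE A B)"
  by (rule bij_betw_byWitness[where f' = "\<lambda>w i. if i \<in> A then w i else 0"])
    (auto simp: choices_def fun_eq_iff PiE_def extensional_def)

lemma card_choices: "finite A \<Longrightarrow> card (choices A B) = (\<Prod>i\<in>A. card (B i))"
  using bij_betw_same_card[OF bij_betw_choices] card_PiE by metis

lemma finite_choices: "finite A \<Longrightarrow> (\<And>i. i \<in> A \<Longrightarrow> finite (B i)) \<Longrightarrow> finite (choices A B)"
  using bij_betw_finite[OF bij_betw_choices] finite_PiE by metis

lemma msgs_eq_choices: "msgs N T R = choices {1..N} (\<lambda>i. {1..nmsg T (R i)})"
  unfolding msgs_def choices_def ..

lemma finite_msgs: "finite (msgs N T R)"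
  unfolding msgs_eq_choices by (rule finite_choices) auto

lemma card_msgs: "card (msgs N T R) = (\<Prod>i\<in>{1..N}. nmsg T (R i))"
  unfolding msgs_eq_choices by (simp add: card_choices)

lemma nmsg_ge: "2 powr (real T * r) \<le> real (nmsg T r)"
  unfolding nmsg_def by (simp add: real_nat_ceiling_ge)

lemma nmsg_pos: "nmsg T r > 0"
  using nmsg_ge[of T r] by (metis gr0I of_nat_0 not_le powr_gt_zero zero_neq_numeral)

lemma card_msgs_pos: "card (msgs N T R) > 0"
  unfolding card_msgs by (intro prod_pos) (simp add: nmsg_pos)

section \<open>Converse: every achievable tuple satisfies the cut bounds\<close>

text \<open>Induction on time, simultaneously for all nodes outside \<open>S\<close>: these transmit
  the same as long as their messages and histories agree, and \<open>S\<close> influences them only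
  through the cut output.\<close>

lemma rx_eq_across_cut:
  assumes "E \<subseteq> V \<times> V" "finite V"
    and "\<And>i. i \<in> V - S \<Longrightarrow> w i = w' i"
    and "\<And>t. t < T \<Longrightarrow>
      cut_output q E n V S (\<lambda>i. f i (Suc t) (w i) (rx q E n f w t i)) =
      cut_output q E n V S (\<lambda>i. f i (Suc t) (w' i) (rx q E n f w' t i))"
    and "j \<in> V - S"
  shows "rx q E n f w T j = rx q E n f w' T j"
  using assms(4,5)
proof (induction T arbitrary: j)
  case 0
  show ?case by simp
next
  case (Suc T)
  define x where "x = (\<lambda>i. f i (Suc T) (w i) (rx q E n f w T i))"
  define x' where "x' = (\<lambda>i. f i (Suc T) (w' i) (rx q E n f w' T i))"
  have finE: "finite E"
    using assms(1,2) finite_subset by blast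
  have IH: "rx q E n f w T i = rx q E n f w' T i" if "i \<in> V - S" for i
    using Suc.IH[OF Suc.prems(1) that] by simp
  \<comment> \<open>By additivity a reception is the sum of what comes from \<open>S\<close> and
    what comes from the other nodes.\<close>
  have split: "recv q E n j z k \<longleftrightarrow>
      cut_output q E n V S z j k \<noteq> recv q E n j (\<lambda>i k. i \<notin> S \<and> z i k) k" for z k
  proof -
    have "recv q E n j z k =
      recv q E n j (\<lambda>i k. (i \<in> S \<and> z i k) \<noteq> (i \<notin> S \<and> z i k)) k"
      by (intro fun_cong[OF recv_cong]) auto
    also have "\<dots> \<longleftrightarrow>
      recv q E n j (\<lambda>i k. i \<in> S \<and> z i k) k \<noteq> recv q E n j (\<lambda>i k. i \<notin> S \<and> z i k) k"
      by (rule recv_xor[OF finE])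
    finally show ?thesis
      using Suc.prems(2) by (simp add: cut_output_def)
  qed
  have "cut_output q E n V S x = cut_output q E n V S x'"
    using Suc.prems(1)[of T] by (simp add: x_def x'_def)
  moreover have "recv q E n j (\<lambda>i k. i \<notin> S \<and> x i k) = recv q E n j (\<lambda>i k. i \<notin> S \<and> x' i k)"
  proof (rule recv_cong)
    fix i assume "(i, j) \<in> E"
    then have "i \<in> V" using assms(1) by auto
    then show "(\<lambda>k. i \<notin> S \<and> x i k) = (\<lambda>k. i \<notin> S \<and> x' i k)"
      using IH assms(3) by (cases "i \<in> S") (auto simp: x_def x'_def)
  qed
  ultimately have "recv q E n j x k = recv q E n j x' k" for k
    by (simp only: split[of x] split[of x'])
  then have "recv q E n j x = recv q E n j x'"
    by blast
  then show ?case
    using IH Suc.prems(2) by (simp add: x_def x'_def)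
qed

text \<open>A correctly decoded tuple is determined by its messages outside \<open>S\<close>, kept
  by \<open>u\<close>, together with its \<open>T\<close> cut outputs, each of which takes
  \<open>2 ^ rank\<close> values.\<close>

lemma card_decodable_le:
  assumes "q \<ge> 1" "d \<notin> {1..N}" "E \<subseteq> insert d {1..N} \<times> insert d {1..N}" "S \<subseteq> {1..N}"
  shows "card {w \<in> msgs N T R. \<forall>i\<in>{1..N}. g (rx q E n f w T d) i = w i}
    \<le> (\<Prod>i\<in>{1..N} - S. nmsg T (R i)) * 2 ^ (cut_rank q E n (insert d {1..N}) S * T)"
proof -
  define V where "V = insert d {1..N}"
  define C where "C = {w \<in> msgs N T R. \<forall>i\<in>{1..N}. g (rx q E n f w T d) i = w i}"
  define Y where "Y = range (cut_output q E n V S)"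
  define U where "U = choices ({1..N} - S) (\<lambda>i. {1..nmsg T (R i)})"
  define u where "u w = (\<lambda>i. if i \<in> S then 0 else w i)" for w :: "nat \<Rightarrow> nat"
  define z where "z w t = cut_output q E n V S (\<lambda>i. f i (Suc t) (w i) (rx q E n f w t i))" for w t
  have SV: "S \<subseteq> V" "finite V" and dV: "d \<in> V - S"
    using assms(2,4) by (auto simp: V_def)
  have cardY: "card Y = 2 ^ cut_rank q E n V S"
    unfolding Y_def by (rule card_range_cut_output[OF assms(1) SV(2,1)])
  then have finY: "finite Y"
    by (metis card.infinite power_not_zero zero_neq_numeral)
  have inj: "inj_on (\<lambda>w. (u w, map (z w) [0..<T])) C"
  proof (rule inj_onI)
    fix w w' assume ww: "w \<in> C" "w' \<in> C"
      and eq: "(u w, map (z w) [0..<T]) = (u w', map (z w') [0..<T])"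
    have "rx q E n f w T d = rx q E n f w' T d"
    proof (rule rx_eq_across_cut[OF _ SV(2) _ _ dV])
      show "E \<subseteq> V \<times> V" using assms(3) by (simp add: V_def)
      show "w i = w' i" if "i \<in> V - S" for i
        using eq that by (auto simp: u_def dest: fun_cong[of _ _ i])
      show "cut_output q E n V S (\<lambda>i. f i (Suc t) (w i) (rx q E n f w t i)) =
        cut_output q E n V S (\<lambda>i. f i (Suc t) (w' i) (rx q E n f w' t i))" if "t < T" for t
        using eq that by (auto simp: z_def)
    qed
    \<comment> \<open>Equal receptions at \<open>d\<close> are decoded alike, and both tuples in
      \<open>C\<close> are decoded correctly.\<close>
    then have "w i = w' i" if "i \<in> {1..N}" for i
      using ww that unfolding C_def by (metis (mono_tags, lifting) mem_Collect_eq)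
    moreover have "w i = w' i" if "i \<notin> {1..N}" for i
      using ww that unfolding C_def msgs_def by auto
    ultimately show "w = w'" by blast
  qed
  have img: "(\<lambda>w. (u w, map (z w) [0..<T])) ` C \<subseteq> U \<times> {ys. set ys \<subseteq> Y \<and> length ys = T}"
    using assms(4) by (auto simp: C_def U_def u_def msgs_def choices_def Y_def z_def)
  have finU: "finite U"
    unfolding U_def by (rule finite_choices) auto
  have "card C \<le> card (U \<times> {ys. set ys \<subseteq> Y \<and> length ys = T})"
    by (rule card_inj_on_le[OF inj img]) (simp add: finU finY finite_lists_length_eq)
  also have "\<dots> = (\<Prod>i\<in>{1..N} - S. nmsg T (R i)) * 2 ^ (cut_rank q E n V S * T)"
    by (simp add: card_cartesian_product card_lists_length_eq finY cardY U_def card_choices power_mult)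
  finally show ?thesis
    unfolding C_def V_def .
qed

text \<open>In the fraction of correctly decoded tuples the messages outside \<open>S\<close>
  cancel, and each node of \<open>S\<close> has at least \<open>2 powr (T * R i)\<close>
  messages.\<close>

lemma err_prob_ge:
  assumes "q \<ge> 1" "d \<notin> {1..N}" "E \<subseteq> insert d {1..N} \<times> insert d {1..N}" "S \<subseteq> {1..N}"
  shows "1 - err_prob q E n N d T R f g
    \<le> (2 powr (real (cut_rank q E n (insert d {1..N}) S) - (\<Sum>i\<in>S. R i))) ^ T"
proof -
  define \<rho> where "\<rho> = cut_rank q E n (insert d {1..N}) S"
  define C where "C = {w \<in> msgs N T R. \<forall>i\<in>{1..N}. g (rx q E n f w T d) i = w i}"
  define B where "B = {w \<in> msgs N T R. \<exists>i\<in>{1..N}. g (rx q E n f w T d) i \<noteq> w i}"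
  have finS: "finite S" using assms(4) finite_subset by blast
  have "msgs N T R = B \<union> C" "B \<inter> C = {}" "finite B" "finite C"
    using finite_msgs[of N T R] by (auto simp: B_def C_def)
  then have cardBC: "real (card (msgs N T R)) = real (card B) + real (card C)"
    by (metis card_Un_disjoint of_nat_add)
  have pos: "real (card (msgs N T R)) > 0"
    using card_msgs_pos by simp
  have split: "card (msgs N T R) = (\<Prod>i\<in>S. nmsg T (R i)) * (\<Prod>i\<in>{1..N} - S. nmsg T (R i))"
    unfolding card_msgs using assms(4) by (simp add: prod.subset_diff mult.commute)
  have posU: "real (\<Prod>i\<in>{1..N} - S. nmsg T (R i)) > 0"
    unfolding of_nat_0_less_iff by (intro prod_pos) (simp add: nmsg_pos)
  have posS: "real (\<Prod>i\<in>S. nmsg T (R i)) > 0"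
    unfolding of_nat_0_less_iff by (intro prod_pos) (simp add: nmsg_pos)
  have cancel: "a * b / (c * a) = b / c" if "a > 0" for a b c :: real
    using that by simp
  have low: "2 powr (real T * (\<Sum>i\<in>S. R i)) \<le> real (\<Prod>i\<in>S. nmsg T (R i))"
  proof -
    have "2 powr (real T * (\<Sum>i\<in>S. R i)) = (\<Prod>i\<in>S. 2 powr (real T * R i))"
      by (simp add: sum_distrib_left powr_sum finS)
    also have "\<dots> \<le> (\<Prod>i\<in>S. real (nmsg T (R i)))"
      by (intro prod_mono) (simp add: nmsg_ge)
    finally show ?thesis by simp
  qed
  have "1 - err_prob q E n N d T R f g = real (card C) / real (card (msgs N T R))"
    using pos cardBC unfolding err_prob_def B_def[symmetric] by (simp add: field_simps)
  also have "\<dots> \<le> real ((\<Prod>i\<in>{1..N} - S. nmsg T (R i)) * 2 ^ (\<rho> * T)) / real (card (msgs N T R))"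
    using card_decodable_le[OF assms, of T R g n f] pos unfolding C_def \<rho>_def
    by (intro divide_right_mono) (simp_all only: of_nat_le_iff of_nat_0_le_iff)
  also have "\<dots> = 2 ^ (\<rho> * T) / real (\<Prod>i\<in>S. nmsg T (R i))"
    unfolding split of_nat_mult cancel[OF posU] by simp
  also have "\<dots> \<le> 2 ^ (\<rho> * T) / 2 powr (real T * (\<Sum>i\<in>S. R i))"
    using low posS by (intro divide_left_mono mult_pos_pos) auto
  also have "\<dots> = 2 powr real (\<rho> * T) / 2 powr (real T * (\<Sum>i\<in>S. R i))"
    by (subst powr_realpow) simp_all
  also have "\<dots> = 2 powr (real T * (real \<rho> - (\<Sum>i\<in>S. R i)))"
    unfolding powr_diff[symmetric] by (simp add: right_diff_distrib mult.commute)
  also have "\<dots> = (2 powr (real \<rho> - (\<Sum>i\<in>S. R i))) ^ T"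
    by (simp add: powr_power)
  finally show ?thesis
    unfolding \<rho>_def .
qed

text \<open>If a cut bound failed, the probability of correct decoding would be at most
  \<open>b ^ T\<close> with \<open>b < 1\<close> and could not tend to one.\<close>

lemma achievable_imp_cut_bound:
  assumes "q \<ge> 1" "d \<notin> {1..N}" "E \<subseteq> insert d {1..N} \<times> insert d {1..N}" "S \<subseteq> {1..N}"
    and "achievable q E n N d R"
  shows "(\<Sum>i\<in>S. R i) \<le> real (cut_rank q E n (insert d {1..N}) S)"
proof (rule ccontr)
  define b where "b = 2 powr (real (cut_rank q E n (insert d {1..N}) S) - (\<Sum>i\<in>S. R i))"
  assume "\<not> ?thesis"
  then have "b < 2 powr 0"
    unfolding b_def by (intro powr_less_mono) auto
  then have b: "0 \<le> b" "b < 1"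
    by (auto simp: b_def)
  obtain f g where lim: "(\<lambda>T. err_prob q E n N d T R (f T) (g T)) \<longlonglongrightarrow> 0"
    using assms(5) unfolding achievable_def by blast
  have "(\<lambda>T. 1 - err_prob q E n N d T R (f T) (g T)) \<longlonglongrightarrow> 1 - 0"
    by (intro tendsto_intros lim)
  moreover have "(\<lambda>T. b ^ T) \<longlonglongrightarrow> 0"
    by (rule LIMSEQ_power_zero) (use b in auto)
  ultimately have "(1 - 0 :: real) \<le> 0"
    by (rule LIMSEQ_le) (use err_prob_ge[OF assms(1-4)] in \<open>auto simp: b_def\<close>)
  then show False by simp
qed

section \<open>Achievability: growth of the distinguishing set in one random step\<close>

text \<open>A counting form of the statement that \<open>P\<close> has probability at most
  \<open>1 / card Z\<close>. If \<open>\<sigma> z F = \<sigma> z' F'\<close> with \<open>P F\<close>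
  and \<open>P F'\<close>, then applying \<open>\<sigma> z\<close> and \<open>\<sigma> z'\<close> to
  this common point gives back \<open>F\<close> and \<open>F'\<close>, so \<open>z = z'\<close> and
  \<open>F = F'\<close>.\<close>

lemma card_mult_le_of_involutions:
  assumes "finite \<Omega>"
    and "\<And>z F. z \<in> Z \<Longrightarrow> F \<in> \<Omega> \<Longrightarrow> \<sigma> z F \<in> \<Omega> \<and> \<sigma> z (\<sigma> z F) = F"
    and "\<And>F z z'. F \<in> \<Omega> \<Longrightarrow> z \<in> Z \<Longrightarrow> z' \<in> Z \<Longrightarrow> P (\<sigma> z F) \<Longrightarrow> P (\<sigma> z' F) \<Longrightarrow> z = z'"
  shows "card {F \<in> \<Omega>. P F} * card Z \<le> card \<Omega>"
proof -
  have "inj_on (\<lambda>(F, z). \<sigma> z F) ({F \<in> \<Omega>. P F} \<times> Z)"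
  proof (rule inj_onI)
    fix a b assume a: "a \<in> {F \<in> \<Omega>. P F} \<times> Z" and b: "b \<in> {F \<in> \<Omega>. P F} \<times> Z"
      and eq: "(\<lambda>(F, z). \<sigma> z F) a = (\<lambda>(F, z). \<sigma> z F) b"
    obtain F z where F: "a = (F, z)" "F \<in> \<Omega>" "P F" "z \<in> Z" using a by blast
    obtain F' z' where F': "b = (F', z')" "F' \<in> \<Omega>" "P F'" "z' \<in> Z" using b by blast
    have G: "\<sigma> z F \<in> \<Omega>" "\<sigma> z (\<sigma> z F) = F" "\<sigma> z' (\<sigma> z F) = F'"
      using assms(2)[OF F(4,2)] assms(2)[OF F'(4,2)] eq F(1) F'(1) by auto
    have "z = z'"
      by (rule assms(3)[OF G(1) F(4) F'(4)]) (use G(2,3) F(3) F'(3) in auto)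
    then show "a = b"
      using G(2,3) F(1) F'(1) by simp
  qed
  then have "card ({F \<in> \<Omega>. P F} \<times> Z) \<le> card \<Omega>"
    by (rule card_inj_on_le) (use assms(1,2) in auto)
  then show ?thesis
    by (simp add: card_cartesian_product)
qed

lemma cut_output_xor:
  assumes "finite E"
  shows "cut_output q E n V S (\<lambda>i k. x i k \<noteq> x' i k) j k \<longleftrightarrow>
    cut_output q E n V S x j k \<noteq> cut_output q E n V S x' j k"
proof -
  have "recv q E n j (\<lambda>i k. i \<in> S \<and> (x i k \<noteq> x' i k)) k =
    recv q E n j (\<lambda>i k. (i \<in> S \<and> x i k) \<noteq> (i \<in> S \<and> x' i k)) k"
    by (intro fun_cong[OF recv_cong]) auto
  also have "\<dots> \<longleftrightarrow>
    recv q E n j (\<lambda>i k. i \<in> S \<and> x i k) k \<noteq> recv q E n j (\<lambda>i k. i \<in> S \<and> x' i k) k"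
    by (rule recv_xor[OF assms])
  finally show ?thesis
    unfolding cut_output_def by blast
qed

text \<open>Allows a preimage of a cut output to be cut off at coordinate \<open>q\<close>, so that
  adding it to a member of \<open>signals q\<close> stays in \<open>signals q\<close>.\<close>

lemma cut_output_truncate:
  "cut_output q E n V S (\<lambda>i k. k < q \<and> x i k) = cut_output q E n V S x"
  unfolding cut_output_def recv_def
  by (intro ext conj_cong refl arg_cong[where f = "\<lambda>A. odd (card A)"]) auto

text \<open>The set \<open>D\<close> of the outline for the pair \<open>p\<close> after
  \<open>t\<close> steps. If both tuples agree at \<open>d\<close>, as those in \<open>msgs\<close>
  do for \<open>d\<close> outside \<open>{1..N}\<close>, then \<open>d\<close> belongs to it exactly
  when its two reception histories differ.\<close>

definition distinguishing ::
  "nat \<Rightarrow> (nat \<times> nat) set \<Rightarrow> (nat \<times> nat \<Rightarrow> nat) \<Rightarrow> nat set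
    \<Rightarrow> (nat \<Rightarrow> nat \<Rightarrow> nat \<Rightarrow> (nat \<Rightarrow> bool) list \<Rightarrow> (nat \<Rightarrow> bool))
    \<Rightarrow> (nat \<Rightarrow> nat) \<times> (nat \<Rightarrow> nat) \<Rightarrow> nat \<Rightarrow> nat set" where
  "distinguishing q E n V f p t =
     {i \<in> V. fst p i \<noteq> snd p i \<or> rx q E n f (fst p) t i \<noteq> rx q E n f (snd p) t i}"

lemma distinguishing_Suc: "distinguishing q E n V f p t \<subseteq> distinguishing q E n V f p (Suc t)"
  by (auto simp: distinguishing_def)

lemma distinguishing_initial:
  "{i \<in> V. fst p i \<noteq> snd p i} \<subseteq> distinguishing q E n V f p t"
  by (auto simp: distinguishing_def)

text \<open>Nodes outside \<open>D\<close> transmit the same for both tuples, so the difference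
  received at \<open>j\<close> outside \<open>D\<close> is the cut output of the transmitted
  difference. Were it nonzero, \<open>j\<close> would join the set.\<close>

lemma distinguishing_stays:
  assumes "E \<subseteq> V \<times> V" "finite V"
    and "distinguishing q E n V f (w, w') (Suc t) = distinguishing q E n V f (w, w') t"
  shows "\<not> cut_output q E n V (distinguishing q E n V f (w, w') t)
    (\<lambda>i k. f i (Suc t) (w i) (rx q E n f w t i) k \<noteq> f i (Suc t) (w' i) (rx q E n f w' t i) k) j k"
proof
  define D where "D = distinguishing q E n V f (w, w') t"
  define x where "x = (\<lambda>i. f i (Suc t) (w i) (rx q E n f w t i))"
  define x' where "x' = (\<lambda>i. f i (Suc t) (w' i) (rx q E n f w' t i))"
  have finE: "finite E"
    using assms(1,2) finite_subset by blast
  assume "cut_output q E n V (distinguishing q E n V f (w, w') t)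
    (\<lambda>i k. f i (Suc t) (w i) (rx q E n f w t i) k \<noteq> f i (Suc t) (w' i) (rx q E n f w' t i) k) j k"
  then have j: "j \<in> V - D" and r: "recv q E n j (\<lambda>i k. i \<in> D \<and> (x i k \<noteq> x' i k)) k"
    by (auto simp: cut_output_def D_def x_def x'_def)
  have "recv q E n j (\<lambda>i k. i \<in> D \<and> (x i k \<noteq> x' i k)) = recv q E n j (\<lambda>i k. x i k \<noteq> x' i k)"
  proof (rule recv_cong)
    fix i assume "(i, j) \<in> E"
    then have "i \<in> V" using assms(1) by auto
    then show "(\<lambda>k. i \<in> D \<and> (x i k \<noteq> x' i k)) = (\<lambda>k. x i k \<noteq> x' i k)"
      by (auto simp: D_def distinguishing_def x_def x'_def)
  qed
  with r have "recv q E n j (\<lambda>i k. x i k \<noteq> x' i k) k"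
    by (simp only:)
  then have "recv q E n j x k \<noteq> recv q E n j x' k"
    by (rule recv_xor[OF finE, THEN iffD1])
  moreover have "rx q E n f w (Suc t) j = rx q E n f w' (Suc t) j"
    using j assms(3) unfolding D_def by (auto simp: distinguishing_def)
  then have "recv q E n j x = recv q E n j x'"
    by (simp add: x_def x'_def)
  ultimately show False by simp
qed

text \<open>All encoders of time \<open>t\<close> are packed into one function of node, message and
  history, the object drawn at random in a single step.\<close>

definition set_step ::
  "(nat \<Rightarrow> nat \<Rightarrow> nat \<Rightarrow> (nat \<Rightarrow> bool) list \<Rightarrow> (nat \<Rightarrow> bool)) \<Rightarrow> nat
    \<Rightarrow> (nat \<times> nat \<times> (nat \<Rightarrow> bool) list \<Rightarrow> (nat \<Rightarrow> bool))
    \<Rightarrow> (nat \<Rightarrow> nat \<Rightarrow> nat \<Rightarrow> (nat \<Rightarrow> bool) list \<Rightarrow> (nat \<Rightarrow> bool))" where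
  "set_step f t F = (\<lambda>i s a ys. if s = t then F (i, a, ys) else f i s a ys)"

lemma set_step_same: "set_step f t F i t a ys = F (i, a, ys)"
  by (simp add: set_step_def)

lemma rx_set_step: "s < t \<Longrightarrow> rx q E n (set_step f t F) w s = rx q E n f w s"
  by (induction s) (auto simp: set_step_def)

lemma distinguishing_set_step:
  "s < t \<Longrightarrow> distinguishing q E n V (set_step f t F) p s = distinguishing q E n V f p s"
  by (simp add: distinguishing_def rx_set_step)

text \<open>Only arguments that occur for some tuple in \<open>M\<close> are kept, which makes the
  sample space of a step finite.\<close>

definition keys where
  "keys q E n V f M t = (\<lambda>(w, i). (i, w i, rx q E n f w t i)) ` (M \<times> V)"

definition signals :: "nat \<Rightarrow> (nat \<Rightarrow> bool) set" where
  "signals q = {x. \<forall>k. x k \<longrightarrow> k < q}"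

lemma finite_signals: "finite (signals q)"
proof -
  have "signals q \<subseteq> (\<lambda>A k. k \<in> A) ` Pow {..<q}"
  proof
    fix x assume "x \<in> signals q"
    then show "x \<in> (\<lambda>A k. k \<in> A) ` Pow {..<q}"
      by (intro image_eqI[of _ _ "{k. x k}"]) (auto simp: signals_def)
  qed
  then show ?thesis
    using finite_subset by blast
qed

text \<open>Uniform choice from this product draws an independent signal for every key; since keys
  contain the node, different nodes draw independently.\<close>

definition steps where
  "steps q E n V f M t = PiE (keys q E n V f M t) (\<lambda>_. signals q)"

lemma finite_steps: "finite M \<Longrightarrow> finite V \<Longrightarrow> finite (steps q E n V f M t)"
  unfolding steps_def by (intro finite_PiE) (auto simp: keys_def finite_signals)

lemma steps_nonempty: "steps q E n V f M t \<noteq> {}"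
proof -
  have "(\<lambda>_. False) \<in> signals q"
    by (simp add: signals_def)
  then show ?thesis
    unfolding steps_def PiE_eq_empty_iff by blast
qed

text \<open>Adding a fixed input to the values that a step takes on the keys of \<open>w'\<close> shifts
  the output difference across the cut by the image of that input, so among all
  shifts realising distinct cut outputs at most one leaves no difference.\<close>

lemma card_stationary_steps:
  assumes "q \<ge> 1" "E \<subseteq> V \<times> V" "finite V" "finite M" "w \<in> M" "w' \<in> M"
  shows "card {F \<in> steps q E n V f M t.
      distinguishing q E n V (set_step f (Suc t) F) (w, w') (Suc t) =
      distinguishing q E n V f (w, w') t}
    * 2 ^ cut_rank q E n V (distinguishing q E n V f (w, w') t) \<le> card (steps q E n V f M t)"
proof -
  define D where "D = distinguishing q E n V f (w, w') t"
  define Z where "Z = range (cut_output q E n V D)"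
  define pre where "pre z = (SOME x. cut_output q E n V D x = z)" for z
  define key where "key u i = (i, u i, rx q E n f u t i)" for u :: "nat \<Rightarrow> nat" and i
  \<comment> \<open>Only values at the keys of \<open>w'\<close> for nodes in \<open>D\<close> are
    changed. For such nodes the keys of \<open>w\<close> and \<open>w'\<close> differ, so the
    signals sent for \<open>w\<close> are untouched and the transmitted difference moves by exactly
    \<open>pre z\<close>.\<close>
  define \<sigma> where "\<sigma> z F = restrict (\<lambda>\<kappa> k. F \<kappa> k \<noteq>
      (fst \<kappa> \<in> D \<and> \<kappa> = key w' (fst \<kappa>) \<and> k < q \<and> pre z (fst \<kappa>) k)) (keys q E n V f M t)"
    for z :: "nat \<Rightarrow> nat \<Rightarrow> bool" and F
  have finE: "finite E"
    using assms(2,3) finite_subset by blast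
  have DV: "D \<subseteq> V" by (auto simp: D_def distinguishing_def)
  have pre: "cut_output q E n V D (pre z) = z" if "z \<in> Z" for z
    using that someI_ex[of "\<lambda>x. cut_output q E n V D x = z"] by (auto simp: Z_def pre_def)
  have key: "key w i \<in> keys q E n V f M t" "key w' i \<in> keys q E n V f M t" if "i \<in> V" for i
    using that assms(5,6) by (auto simp: keys_def key_def)
  \<comment> \<open>A shift that leaves no difference must cancel the original one, so
    \<open>z\<close> is determined by \<open>F\<close> alone.\<close>
  have outz: "z = cut_output q E n V D (\<lambda>i k. F (key w i) k \<noteq> F (key w' i) k)"
    if z: "z \<in> Z" and stay: "distinguishing q E n V (set_step f (Suc t) (\<sigma> z F)) (w, w') (Suc t) = D"
    for z F
  proof (intro ext)
    fix j k
    let ?f = "set_step f (Suc t) (\<sigma> z F)"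
    have D: "distinguishing q E n V ?f (w, w') t = D"
      by (simp add: distinguishing_set_step D_def)
    have "\<not> cut_output q E n V D (\<lambda>i k. \<sigma> z F (key w i) k \<noteq> \<sigma> z F (key w' i) k) j k"
      using distinguishing_stays[OF assms(2,3), of q n ?f w w' t j k] stay D
      by (simp add: rx_set_step set_step_same key_def)
    also have "cut_output q E n V D (\<lambda>i k. \<sigma> z F (key w i) k \<noteq> \<sigma> z F (key w' i) k) j k =
      cut_output q E n V D (\<lambda>i k. (F (key w i) k \<noteq> F (key w' i) k) \<noteq> (k < q \<and> pre z i k)) j k"
    proof -
      have "(i \<in> D \<and> (\<sigma> z F (key w i) k \<noteq> \<sigma> z F (key w' i) k)) =
        (i \<in> D \<and> ((F (key w i) k \<noteq> F (key w' i) k) \<noteq> (k < q \<and> pre z i k)))" for i k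
      proof (cases "i \<in> D")
        case True
        then have "i \<in> V" "key w i \<noteq> key w' i"
          by (auto simp: D_def distinguishing_def key_def)
        then show ?thesis
          using True key[of i] by (simp add: \<sigma>_def) (auto simp: key_def)
      qed auto
      then show ?thesis
        by (simp add: cut_output_def)
    qed
    also have "\<dots> \<longleftrightarrow> cut_output q E n V D (\<lambda>i k. F (key w i) k \<noteq> F (key w' i) k) j k \<noteq>
      cut_output q E n V D (\<lambda>i k. k < q \<and> pre z i k) j k"
      by (rule cut_output_xor[OF finE])
    finally show "z j k = cut_output q E n V D (\<lambda>i k. F (key w i) k \<noteq> F (key w' i) k) j k"
      by (simp add: cut_output_truncate pre[OF z])
  qed
  have "card {F \<in> steps q E n V f M t.
      distinguishing q E n V (set_step f (Suc t) F) (w, w') (Suc t) = D} * card Z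
    \<le> card (steps q E n V f M t)"
  proof (rule card_mult_le_of_involutions[where \<sigma> = \<sigma>])
    show "finite (steps q E n V f M t)"
      using assms(3,4) by (rule finite_steps[rotated])
    show "\<sigma> z F \<in> steps q E n V f M t \<and> \<sigma> z (\<sigma> z F) = F"
      if "z \<in> Z" "F \<in> steps q E n V f M t" for z F
    proof
      show "\<sigma> z F \<in> steps q E n V f M t"
        unfolding steps_def
      proof (rule PiE_I)
        fix \<kappa> assume \<kappa>: "\<kappa> \<in> keys q E n V f M t"
        then have "F \<kappa> \<in> signals q"
          using that(2) unfolding steps_def by (rule PiE_mem[rotated])
        then show "\<sigma> z F \<kappa> \<in> signals q"
          using \<kappa> by (auto simp: \<sigma>_def signals_def)
      qed (simp add: \<sigma>_def)
      show "\<sigma> z (\<sigma> z F) = F"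
      proof
        fix \<kappa>
        show "\<sigma> z (\<sigma> z F) \<kappa> = F \<kappa>"
        proof (cases "\<kappa> \<in> keys q E n V f M t")
          case True
          have "((a \<noteq> b) \<noteq> b) = a" for a b by blast
          with True have "\<sigma> z (\<sigma> z F) \<kappa> k = F \<kappa> k" for k
            unfolding \<sigma>_def restrict_apply by (simp only: if_True)
          then show ?thesis by blast
        next
          case False
          then show ?thesis
            using PiE_arb[OF that(2)[unfolded steps_def]] by (simp add: \<sigma>_def)
        qed
      qed
    qed
  next
    fix F z z'
    assume "z \<in> Z" "z' \<in> Z"
      "distinguishing q E n V (set_step f (Suc t) (\<sigma> z F)) (w, w') (Suc t) = D"
      "distinguishing q E n V (set_step f (Suc t) (\<sigma> z' F)) (w, w') (Suc t) = D"
    then show "z = z'"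
      using outz[of z F] outz[of z' F] by simp
  qed
  moreover have "card Z = 2 ^ cut_rank q E n V D"
    unfolding Z_def by (rule card_range_cut_output[OF assms(1,3) DV])
  ultimately show ?thesis
    by (simp add: D_def)
qed

section \<open>Derandomisation by a potential\<close>

text \<open>Here \<open>k\<close> counts the steps still to come. For \<open>k = 0\<close> and
  \<open>K \<ge> 1\<close> the value bounds the indicator that \<open>d\<close> has not told the
  pair apart.\<close>

definition potential :: "nat set \<Rightarrow> nat \<Rightarrow> real \<Rightarrow> real \<Rightarrow> nat set \<Rightarrow> nat \<Rightarrow> real" where
  "potential V d K l D k = (if d \<in> D then 0 else K ^ card (V - D) * l ^ k)"

text \<open>The average potential does not increase. The set stays put with probability at most
  \<open>1 / 2 ^ rank\<close>; if it grows, the exponent of \<open>K\<close> drops and a factor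
  \<open>1 / K\<close> is gained. The sum of the two factors is at most \<open>l\<close>, which pays
  for the step consumed.\<close>

lemma sum_potential_steps_le:
  assumes "q \<ge> 1" "E \<subseteq> V \<times> V" "finite V" "finite M" "p \<in> M \<times> M" "d \<in> V" "K \<ge> 1" "l \<ge> 0"
    and drift: "d \<notin> distinguishing q E n V f p t \<Longrightarrow>
      1 / 2 ^ cut_rank q E n V (distinguishing q E n V f p t) + 1 / K \<le> l"
  shows "(\<Sum>F\<in>steps q E n V f M t.
      potential V d K l (distinguishing q E n V (set_step f (Suc t) F) p (Suc t)) k)
    \<le> card (steps q E n V f M t) * potential V d K l (distinguishing q E n V f p t) (Suc k)"
proof -
  obtain w w' where p: "p = (w, w')" "w \<in> M" "w' \<in> M"
    using assms(5) by auto
  define \<Omega> where "\<Omega> = steps q E n V f M t"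
  define D where "D = distinguishing q E n V f p t"
  define D' where "D' F = distinguishing q E n V (set_step f (Suc t) F) p (Suc t)" for F
  have sub: "D \<subseteq> D' F" "D' F \<subseteq> V" for F
    using distinguishing_Suc[of q E n V "set_step f (Suc t) F" p t]
    by (auto simp: D_def D'_def distinguishing_set_step) (auto simp: distinguishing_def)
  have "(\<Sum>F\<in>\<Omega>. potential V d K l (D' F) k) \<le> card \<Omega> * potential V d K l D (Suc k)"
  proof (cases "d \<in> D")
    case True
    then have "potential V d K l (D' F) k = 0" for F
      using sub(1) by (auto simp: potential_def)
    then show ?thesis
      using True by (simp add: potential_def)
  next
    case False
    define m where "m = card (V - D)"
    define \<rho> where "\<rho> = cut_rank q E n V D"
    have fin: "finite \<Omega>"
      unfolding \<Omega>_def using assms(3,4) by (rule finite_steps[rotated])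
    \<comment> \<open>The destination itself lies in \<open>V - D\<close>, so \<open>m - 1\<close>
      is a genuine predecessor.\<close>
    have m: "m \<ge> 1"
      using False assms(3,6) by (auto simp: m_def Suc_le_eq card_gt_0_iff)
    have Km: "K ^ m = K * K ^ (m - 1)"
      using m by (cases m) auto
    \<comment> \<open>The first summand covers a stationary step, the second a growing one,
      including the case that \<open>d\<close> is reached and the potential vanishes.\<close>
    have "potential V d K l (D' F) k \<le> of_bool (D' F = D) * (K ^ m * l ^ k) + K ^ m / K * l ^ k" for F
    proof (cases "D' F = D")
      case True
      have "0 \<le> K ^ m / K * l ^ k" using assms(7,8) by simp
      then show ?thesis
        using True False by (simp add: potential_def m_def)
    next
      case neq: False
      then have "card (V - D' F) < card (V - D)"
        using sub[of F] assms(3) by (intro psubset_card_mono) auto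
      then have "K ^ card (V - D' F) \<le> K ^ (m - 1)"
        using assms(7) by (intro power_increasing) (auto simp: m_def)
      then have "K ^ card (V - D' F) * l ^ k \<le> K ^ m / K * l ^ k"
        using assms(7,8) Km by (intro mult_right_mono) auto
      moreover have "0 \<le> K ^ m / K * l ^ k" using assms(7,8) by simp
      ultimately show ?thesis
        using neq by (simp add: potential_def)
    qed
    then have "(\<Sum>F\<in>\<Omega>. potential V d K l (D' F) k) \<le>
        (\<Sum>F\<in>\<Omega>. of_bool (D' F = D) * (K ^ m * l ^ k) + K ^ m / K * l ^ k)"
      by (rule sum_mono)
    also have "\<dots> = card {F \<in> \<Omega>. D' F = D} * (K ^ m * l ^ k) + card \<Omega> * (K ^ m / K * l ^ k)"
      using fin by (simp add: sum.distrib sum_distrib_right[symmetric] Int_def)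
    also have "\<dots> \<le> (card \<Omega> / 2 ^ \<rho>) * (K ^ m * l ^ k) + card \<Omega> * (K ^ m / K * l ^ k)"
    proof -
      have "card {F \<in> \<Omega>. D' F = D} * 2 ^ \<rho> \<le> card \<Omega>"
        unfolding \<Omega>_def D'_def D_def \<rho>_def p(1)
        by (rule card_stationary_steps[OF assms(1-4) p(2,3)])
      then have "real (card {F \<in> \<Omega>. D' F = D} * 2 ^ \<rho>) \<le> real (card \<Omega>)"
        by (simp only: of_nat_le_iff)
      then have "card {F \<in> \<Omega>. D' F = D} \<le> card \<Omega> / (2 ^ \<rho> :: real)"
        by (simp add: field_simps)
      then show ?thesis
        using assms(7,8) by (intro add_right_mono mult_right_mono) auto
    qed
    also have "\<dots> = card \<Omega> * (K ^ m * l ^ k) * (1 / 2 ^ \<rho> + 1 / K)"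
      by (simp add: algebra_simps)
    also have "\<dots> \<le> card \<Omega> * (K ^ m * l ^ k) * l"
      using drift False assms(7,8) unfolding D_def[symmetric] \<rho>_def by (intro mult_left_mono) auto
    also have "\<dots> = card \<Omega> * potential V d K l D (Suc k)"
      using False by (simp add: potential_def m_def)
    finally show ?thesis .
  qed
  then show ?thesis
    by (simp add: \<Omega>_def D_def D'_def)
qed

text \<open>The method of conditional expectations: the total potential does not increase on average
  over a step, hence some choice of the step does not increase it. Fixing that choice leaves the
  earlier encoders unchanged.\<close>

lemma exists_encoder_small_potential:
  fixes K :: real and l :: "(nat \<Rightarrow> nat) \<times> (nat \<Rightarrow> nat) \<Rightarrow> real"
  assumes "q \<ge> 1" "E \<subseteq> V \<times> V" "finite V" "finite M" "P \<subseteq> M \<times> M" "d \<in> V" "K \<ge> 1"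
    and nonneg: "\<And>p. p \<in> P \<Longrightarrow> l p \<ge> 0"
    and drift: "\<And>p D. p \<in> P \<Longrightarrow> {i \<in> V. fst p i \<noteq> snd p i} \<subseteq> D \<Longrightarrow> D \<subseteq> V \<Longrightarrow> d \<notin> D \<Longrightarrow>
      1 / 2 ^ cut_rank q E n V D + 1 / K \<le> l p"
    and "t \<le> T"
  shows "\<exists>f. (\<Sum>p\<in>P. potential V d K (l p) (distinguishing q E n V f p t) (T - t))
    \<le> (\<Sum>p\<in>P. K ^ card V * l p ^ T)"
  using assms(10)
proof (induction t)
  case 0
  have "potential V d K (l p) (distinguishing q E n V f p 0) T \<le> K ^ card V * l p ^ T"
    if "p \<in> P" for p f
  proof -
    have "K ^ card (V - distinguishing q E n V f p 0) \<le> K ^ card V"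
      using assms(3,7) by (intro power_increasing card_mono) auto
    then show ?thesis
      using nonneg[OF that] assms(7) by (auto simp: potential_def intro: mult_right_mono)
  qed
  then show ?case
    by (auto intro!: sum_mono)
next
  case (Suc t)
  then obtain f where f: "(\<Sum>p\<in>P. potential V d K (l p) (distinguishing q E n V f p t) (T - t))
      \<le> (\<Sum>p\<in>P. K ^ card V * l p ^ T)"
    by auto
  define \<Omega> where "\<Omega> = steps q E n V f M t"
  define \<Phi> where "\<Phi> F = (\<Sum>p\<in>P. potential V d K (l p)
      (distinguishing q E n V (set_step f (Suc t) F) p (Suc t)) (T - Suc t))" for F
  define \<Psi> where "\<Psi> = (\<Sum>p\<in>P. potential V d K (l p) (distinguishing q E n V f p t) (T - t))"
  have T: "T - t = Suc (T - Suc t)"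
    using Suc.prems by simp
  have fin: "finite \<Omega>" "\<Omega> \<noteq> {}"
    unfolding \<Omega>_def using assms(3,4) by (auto simp: finite_steps steps_nonempty)
  have "(\<Sum>F\<in>\<Omega>. \<Phi> F) = (\<Sum>p\<in>P. \<Sum>F\<in>\<Omega>. potential V d K (l p)
      (distinguishing q E n V (set_step f (Suc t) F) p (Suc t)) (T - Suc t))"
    unfolding \<Phi>_def by (rule sum.swap)
  also have "\<dots> \<le> (\<Sum>p\<in>P. card \<Omega> * potential V d K (l p) (distinguishing q E n V f p t) (T - t))"
    unfolding \<Omega>_def T
  proof (rule sum_mono, rule sum_potential_steps_le[OF assms(1-4) _ assms(6,7)])
    fix p assume p: "p \<in> P"
    show "p \<in> M \<times> M" using p assms(5) by auto
    show "l p \<ge> 0" using nonneg[OF p] .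
    show "1 / 2 ^ cut_rank q E n V (distinguishing q E n V f p t) + 1 / K \<le> l p"
      if "d \<notin> distinguishing q E n V f p t"
      using that by (intro drift[OF p distinguishing_initial]) (auto simp: distinguishing_def)
  qed
  also have "\<dots> = card \<Omega> * \<Psi>"
    by (simp add: \<Psi>_def sum_distrib_left)
  finally have avg: "(\<Sum>F\<in>\<Omega>. \<Phi> F) \<le> card \<Omega> * \<Psi>" .
  have "\<exists>F\<in>\<Omega>. \<Phi> F \<le> \<Psi>"
  proof (rule ccontr)
    assume "\<not> ?thesis"
    then have "(\<Sum>F\<in>\<Omega>. \<Psi>) < (\<Sum>F\<in>\<Omega>. \<Phi> F)"
      using fin by (intro sum_strict_mono) auto
    then show False using avg by simp
  qed
  then show ?case
    using f unfolding \<Phi>_def \<Psi>_def by (meson order_trans)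
qed

text \<open>After all \<open>T\<close> steps each pair not yet told apart by \<open>d\<close> has
  potential at least one, so their number is bounded by the total potential.\<close>

lemma exists_encoder_few_collisions:
  fixes K :: real and l :: "(nat \<Rightarrow> nat) \<times> (nat \<Rightarrow> nat) \<Rightarrow> real"
  assumes "q \<ge> 1" "E \<subseteq> V \<times> V" "finite V" "finite M" "P \<subseteq> M \<times> M" "d \<in> V" "K \<ge> 1"
    and "\<And>p. p \<in> P \<Longrightarrow> l p \<ge> 0"
    and "\<And>p D. p \<in> P \<Longrightarrow> {i \<in> V. fst p i \<noteq> snd p i} \<subseteq> D \<Longrightarrow> D \<subseteq> V \<Longrightarrow> d \<notin> D \<Longrightarrow>
      1 / 2 ^ cut_rank q E n V D + 1 / K \<le> l p"
  shows "\<exists>f. card {p \<in> P. d \<notin> distinguishing q E n V f p T} \<le> (\<Sum>p\<in>P. K ^ card V * l p ^ T)"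
proof -
  obtain f where f: "(\<Sum>p\<in>P. potential V d K (l p) (distinguishing q E n V f p T) (T - T))
      \<le> (\<Sum>p\<in>P. K ^ card V * l p ^ T)"
    using exists_encoder_small_potential[where l = l and t = T and T = T, OF assms] by auto
  have finP: "finite P"
    using assms(4,5) finite_subset by blast
  have "real (card {p \<in> P. d \<notin> distinguishing q E n V f p T})
      = (\<Sum>p\<in>P. of_bool (d \<notin> distinguishing q E n V f p T))"
    using finP by (simp add: Int_def)
  also have "\<dots> \<le> (\<Sum>p\<in>P. potential V d K (l p) (distinguishing q E n V f p T) (T - T))"
    using assms(7) by (intro sum_mono) (auto simp: potential_def one_le_power)
  finally show ?thesis
    using f by (meson order_trans)
qed

section \<open>Union bound over pairs of message tuples\<close>

text \<open>Leaving out the message actually sent makes up for the ceiling, so counting wrong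
  messages costs no extra constant.\<close>

lemma nmsg_minus_one_le: "real (nmsg T r - 1) \<le> 2 powr (real T * r)"
proof -
  define x where "x = 2 powr (real T * r)"
  have "real (nmsg T r) = real_of_int \<lceil>x\<rceil>"
    unfolding nmsg_def x_def by (intro of_nat_nat) (simp add: order_less_le_trans[of "-1" 0])
  also have "\<dots> \<le> x + 1"
    by linarith
  finally show ?thesis
    using nmsg_pos[of T r] unfolding x_def by (simp add: of_nat_diff)
qed

lemma nmsg_zero: "nmsg T 0 = 1"
  by (simp add: nmsg_def)

lemma card_msgs_differing_le:
  assumes "w \<in> msgs N T R" "S \<subseteq> {1..N}"
  shows "real (card {w' \<in> msgs N T R. {i. w i \<noteq> w' i} = S}) \<le> 2 powr (real T * (\<Sum>i\<in>S. R i))"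
proof -
  define W where "W = {w' \<in> msgs N T R. {i. w i \<noteq> w' i} = S}"
  define u where "u w' = (\<lambda>i. if i \<in> S then w' i else 0)" for w' :: "nat \<Rightarrow> nat"
  define B where "B = choices S (\<lambda>i. {1..nmsg T (R i)} - {w i})"
  have finS: "finite S" using assms(2) finite_subset by blast
  have "inj_on u W"
  proof (rule inj_onI)
    fix a b assume "a \<in> W" "b \<in> W" "u a = u b"
    have "a i = b i" for i
    proof (cases "i \<in> S")
      case True
      then show ?thesis using fun_cong[OF \<open>u a = u b\<close>, of i] by (simp add: u_def)
    next
      case False
      then have "w i = a i" "w i = b i"
        using \<open>a \<in> W\<close> \<open>b \<in> W\<close> by (auto simp: W_def)
      then show ?thesis by simp
    qed
    then show "a = b" by blast
  qed
  moreover have "u ` W \<subseteq> B"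
    using assms(2) by (fastforce simp: u_def W_def B_def choices_def msgs_def)
  moreover have "finite B"
    unfolding B_def by (rule finite_choices[OF finS]) auto
  ultimately have "card W \<le> card B"
    by (rule card_inj_on_le)
  also have "card B = (\<Prod>i\<in>S. nmsg T (R i) - 1)"
    unfolding B_def card_choices[OF finS]
  proof (rule prod.cong)
    fix i assume "i \<in> S"
    then have "w i \<in> {1..nmsg T (R i)}"
      using assms by (auto simp: msgs_def)
    then show "card ({1..nmsg T (R i)} - {w i}) = nmsg T (R i) - 1"
      by simp
  qed simp
  finally have "real (card W) \<le> (\<Prod>i\<in>S. real (nmsg T (R i) - 1))"
    unfolding of_nat_prod[symmetric] by (simp only: of_nat_le_iff)
  also have "\<dots> \<le> (\<Prod>i\<in>S. 2 powr (real T * R i))"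
    by (intro prod_mono) (simp only: nmsg_minus_one_le of_nat_0_le_iff)
  also have "\<dots> = 2 powr (real T * (\<Sum>i\<in>S. R i))"
    by (simp add: sum_distrib_left powr_sum finS)
  finally show ?thesis
    unfolding W_def .
qed

text \<open>For a fixed first tuple, group the second by the set \<open>S\<close> of differing
  positions. The number of such tuples cancels the power of two in the summand, leaving
  \<open>\<theta> ^ T\<close> for each of the \<open>2 ^ N\<close> sets.\<close>

lemma sum_pairs_geometric_le:
  fixes \<theta> :: real
  assumes "\<theta> \<ge> 0"
  shows "(\<Sum>p\<in>msgs N T R \<times> msgs N T R.
      (\<theta> * 2 powr - (\<Sum>i\<in>{i. fst p i \<noteq> snd p i}. R i)) ^ T)
    \<le> card (msgs N T R) * (2 ^ N * \<theta> ^ T)"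
proof -
  define h where "h S = (\<theta> * 2 powr - (\<Sum>i\<in>S. R i)) ^ T" for S
  have row: "(\<Sum>w'\<in>msgs N T R. h {i. w i \<noteq> w' i}) \<le> 2 ^ N * \<theta> ^ T" if w: "w \<in> msgs N T R" for w
  proof -
    have "(\<lambda>w'. {i. w i \<noteq> w' i}) ` msgs N T R \<subseteq> Pow {1..N}"
      using w unfolding msgs_def by force
    then have "(\<Sum>w'\<in>msgs N T R. h {i. w i \<noteq> w' i}) =
        (\<Sum>S\<in>Pow {1..N}. \<Sum>w'\<in>{w' \<in> msgs N T R. {i. w i \<noteq> w' i} = S}. h {i. w i \<noteq> w' i})"
      by (intro sum.group[symmetric] finite_msgs) auto
    also have "\<dots> \<le> (\<Sum>S\<in>Pow {1..N}. \<theta> ^ T)"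
    proof (rule sum_mono)
      fix S assume "S \<in> Pow {1..N}"
      then have S: "S \<subseteq> {1..N}" by simp
      define c where "c = (\<Sum>i\<in>S. R i)"
      have "(\<Sum>w'\<in>{w' \<in> msgs N T R. {i. w i \<noteq> w' i} = S}. h {i. w i \<noteq> w' i})
          = (\<Sum>w'\<in>{w' \<in> msgs N T R. {i. w i \<noteq> w' i} = S}. h S)"
        by (rule sum.cong) auto
      also have "\<dots> = card {w' \<in> msgs N T R. {i. w i \<noteq> w' i} = S} * h S"
        by simp
      also have "\<dots> \<le> 2 powr (real T * c) * h S"
        using card_msgs_differing_le[OF w S] assms unfolding c_def
        by (intro mult_right_mono) (auto simp: h_def)
      also have "\<dots> = \<theta> ^ T * (2 powr (real T * c) * 2 powr (real T * - c))"
        by (simp add: h_def c_def power_mult_distrib powr_power)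
      also have "\<dots> = \<theta> ^ T"
        unfolding powr_add[symmetric] by simp
      finally show "(\<Sum>w'\<in>{w' \<in> msgs N T R. {i. w i \<noteq> w' i} = S}. h {i. w i \<noteq> w' i}) \<le> \<theta> ^ T" .
    qed
    also have "\<dots> = 2 ^ N * \<theta> ^ T"
      by (simp add: card_Pow)
    finally show ?thesis .
  qed
  have "(\<Sum>p\<in>msgs N T R \<times> msgs N T R. h {i. fst p i \<noteq> snd p i})
      = (\<Sum>w\<in>msgs N T R. \<Sum>w'\<in>msgs N T R. h {i. w i \<noteq> w' i})"
    by (simp add: sum.cartesian_product case_prod_beta)
  also have "\<dots> \<le> (\<Sum>w\<in>msgs N T R. 2 ^ N * \<theta> ^ T)"
    by (intro sum_mono row)
  also have "\<dots> = card (msgs N T R) * (2 ^ N * \<theta> ^ T)"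
    by simp
  finally show ?thesis
    unfolding h_def .
qed

section \<open>Codes for rates strictly inside the region\<close>

text \<open>The conditions are continuous in \<open>\<epsilon>\<close>, strict at zero and finite in
  number. The additive \<open>\<epsilon>\<close> makes room for the term \<open>1 / K\<close>, and
  the factor \<open>1 - \<epsilon>\<close> for geometric decay of the error.\<close>

lemma exists_uniform_margin:
  fixes a b :: "'a \<Rightarrow> real"
  assumes "finite Q" "\<And>x. x \<in> Q \<Longrightarrow> a x < b x"
  shows "\<exists>\<epsilon>>0. \<epsilon> < 1 \<and> (\<forall>x\<in>Q. a x + \<epsilon> \<le> (1 - \<epsilon>) * b x)"
proof -
  have "\<forall>\<^sub>F \<epsilon> in at_right 0. a x + \<epsilon> \<le> (1 - \<epsilon>) * b x" if "x \<in> Q" for x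
  proof -
    have "((\<lambda>\<epsilon>. (1 - \<epsilon>) * b x - (a x + \<epsilon>)) \<longlongrightarrow> (1 - 0) * b x - (a x + 0)) (at_right 0)"
      by (intro tendsto_intros)
    then have "\<forall>\<^sub>F \<epsilon> in at_right 0. 0 < (1 - \<epsilon>) * b x - (a x + \<epsilon>)"
      by (rule order_tendstoD) (use assms(2)[OF that] in simp)
    then show ?thesis
      by eventually_elim simp
  qed
  then have "\<forall>\<^sub>F \<epsilon> in at_right 0. \<forall>x\<in>Q. a x + \<epsilon> \<le> (1 - \<epsilon>) * b x"
    using assms(1) by (simp add: eventually_ball_finite)
  moreover have "\<forall>\<^sub>F \<epsilon> in at_right (0 :: real). \<epsilon> \<in> {0<..<1}"
    by (rule eventually_at_right_real) simp
  ultimately have "\<forall>\<^sub>F \<epsilon> in at_right 0. \<epsilon> \<in> {0<..<1} \<and> (\<forall>x\<in>Q. a x + \<epsilon> \<le> (1 - \<epsilon>) * b x)"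
    by eventually_elim simp
  from eventually_happens[OF this] show ?thesis
    by auto
qed

text \<open>A wrongly decoded tuple and the tuple decoded in its place form a pair that
  \<open>d\<close> cannot tell apart; such pairs are few by the potential bound with
  \<open>K = 1 / \<epsilon>\<close>. The margin ranges over all \<open>A\<close> containing the
  differing set \<open>S\<close>, since the distinguishing set may be any of them.\<close>

lemma exists_code_err_prob_le:
  assumes "q \<ge> 1" "d \<notin> {1..N}" "E \<subseteq> insert d {1..N} \<times> insert d {1..N}"
    and R0: "\<And>i. i \<in> {1..N} \<Longrightarrow> 0 \<le> R i"
    and \<epsilon>: "0 < \<epsilon>" "\<epsilon> < 1"
    and margin: "\<And>S A. S \<noteq> {} \<Longrightarrow> S \<subseteq> A \<Longrightarrow> A \<subseteq> {1..N} \<Longrightarrow> (\<And>i. i \<in> S \<Longrightarrow> 0 < R i) \<Longrightarrow>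
      1 / 2 ^ cut_rank q E n (insert d {1..N}) A + \<epsilon> \<le> (1 - \<epsilon>) * 2 powr - (\<Sum>i\<in>S. R i)"
  shows "\<exists>f g. err_prob q E n N d T R f g \<le> (1 / \<epsilon>) ^ Suc N * 2 ^ N * (1 - \<epsilon>) ^ T"
proof -
  define V where "V = insert d {1..N}"
  define M where "M = msgs N T R"
  define P where "P = {p \<in> M \<times> M. fst p \<noteq> snd p}"
  \<comment> \<open>The power of two is chosen to balance the number of pairs with the same
    differing set, so that only \<open>(1 - \<epsilon>) ^ T\<close> survives in the sum.\<close>
  define l where "l p = (1 - \<epsilon>) * 2 powr - (\<Sum>i\<in>{i. fst p i \<noteq> snd p i}. R i)"
    for p :: "(nat \<Rightarrow> nat) \<times> (nat \<Rightarrow> nat)"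
  have V: "finite V" "d \<in> V" "card V = Suc N" "E \<subseteq> V \<times> V"
    using assms(2,3) by (auto simp: V_def)
  have finM: "finite M"
    unfolding M_def by (rule finite_msgs)
  have l0: "l p \<ge> 0" for p
    using \<epsilon> by (simp add: l_def)
  have outside: "w i = 0" if "w \<in> M" "i \<notin> {1..N}" for w i
    using that by (auto simp: M_def msgs_def)
  have "\<exists>f. card {p \<in> P. d \<notin> distinguishing q E n V f p T} \<le> (\<Sum>p\<in>P. (1 / \<epsilon>) ^ card V * l p ^ T)"
  proof (rule exists_encoder_few_collisions[OF assms(1) V(4,1) finM _ V(2)])
    show "P \<subseteq> M \<times> M" by (auto simp: P_def)
    show "1 \<le> 1 / \<epsilon>" using \<epsilon> by simp
    show "0 \<le> l p" for p by (rule l0)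
    fix p D assume p: "p \<in> P" and D: "{i \<in> V. fst p i \<noteq> snd p i} \<subseteq> D" "D \<subseteq> V" "d \<notin> D"
    define S where "S = {i. fst p i \<noteq> snd p i}"
    have pM: "fst p \<in> M" "snd p \<in> M" "fst p \<noteq> snd p"
      using p by (auto simp: P_def)
    have S: "S \<noteq> {}" "S \<subseteq> {1..N}"
    proof -
      show "S \<noteq> {}"
        using pM(3) by (auto simp: S_def)
      show "S \<subseteq> {1..N}"
      proof (rule subsetI, rule ccontr)
        fix i assume "i \<in> S" "i \<notin> {1..N}"
        then show False
          using outside[OF pM(1)] outside[OF pM(2)] by (simp add: S_def)
      qed
    qed
    have "S \<subseteq> V"
      using S(2) by (auto simp: V_def)
    then have "S \<subseteq> D"
      using D(1) unfolding S_def by blast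
    moreover have "D \<subseteq> {1..N}"
      using D(2,3) by (auto simp: V_def)
    \<comment> \<open>A node of rate zero has a single message, so two tuples cannot differ
      there.\<close>
    moreover have "0 < R i" if "i \<in> S" for i
    proof (rule ccontr)
      have i: "i \<in> {1..N}" using that S(2) by auto
      assume "\<not> 0 < R i"
      then have "nmsg T (R i) = 1"
        using R0[OF i] nmsg_zero[of T] by simp
      moreover have "fst p i \<in> {1..nmsg T (R i)}" "snd p i \<in> {1..nmsg T (R i)}"
        using pM(1,2) i unfolding M_def msgs_def by blast+
      ultimately have "fst p i = snd p i"
        by simp
      then show False
        using that by (simp add: S_def)
    qed
    ultimately show "1 / 2 ^ cut_rank q E n V D + 1 / (1 / \<epsilon>) \<le> l p"
      using margin[OF S(1), of D] by (simp add: V_def l_def S_def)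
  qed
  then obtain f where f: "card {p \<in> P. d \<notin> distinguishing q E n V f p T}
      \<le> (\<Sum>p\<in>P. (1 / \<epsilon>) ^ card V * l p ^ T)"
    by blast
  \<comment> \<open>The decoder returns any message tuple consistent with the reception.\<close>
  define g where "g y = (SOME w. w \<in> M \<and> rx q E n f w T d = y)" for y
  have g: "g (rx q E n f w T d) \<in> M" "rx q E n f (g (rx q E n f w T d)) T d = rx q E n f w T d"
    if "w \<in> M" for w
    using someI[of "\<lambda>v. v \<in> M \<and> rx q E n f v T d = rx q E n f w T d" w] that
    by (auto simp: g_def)
  define B where "B = {w \<in> M. \<exists>i\<in>{1..N}. g (rx q E n f w T d) i \<noteq> w i}"
  have "card B \<le> card {p \<in> P. d \<notin> distinguishing q E n V f p T}"
  proof (rule card_inj_on_le)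
    show "inj_on (\<lambda>w. (w, g (rx q E n f w T d))) B"
      by (rule inj_onI) simp
    show "(\<lambda>w. (w, g (rx q E n f w T d))) ` B \<subseteq> {p \<in> P. d \<notin> distinguishing q E n V f p T}"
    proof (rule image_subsetI)
      fix w assume "w \<in> B"
      then have w: "w \<in> M" "g (rx q E n f w T d) \<noteq> w"
        by (auto simp: B_def)
      then show "(w, g (rx q E n f w T d)) \<in> {p \<in> P. d \<notin> distinguishing q E n V f p T}"
        using g[OF w(1)] outside[OF w(1) assms(2)] outside[OF g(1)[OF w(1)] assms(2)]
        by (auto simp: P_def distinguishing_def)
    qed
    show "finite {p \<in> P. d \<notin> distinguishing q E n V f p T}"
      by (rule finite_subset[of _ "M \<times> M"]) (auto simp: P_def finM)
  qed
  then have "real (card B) \<le> (\<Sum>p\<in>P. (1 / \<epsilon>) ^ card V * l p ^ T)"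
    using f by linarith
  also have "\<dots> \<le> (\<Sum>p\<in>M \<times> M. (1 / \<epsilon>) ^ card V * l p ^ T)"
    using l0 \<epsilon> by (intro sum_mono2) (auto simp: P_def finM)
  also have "\<dots> = (1 / \<epsilon>) ^ Suc N * (\<Sum>p\<in>M \<times> M. l p ^ T)"
    by (simp only: V(3) sum_distrib_left)
  also have "\<dots> \<le> (1 / \<epsilon>) ^ Suc N * (card M * (2 ^ N * (1 - \<epsilon>) ^ T))"
    using sum_pairs_geometric_le[where \<theta> = "1 - \<epsilon>" and N = N and T = T and R = R] \<epsilon> unfolding l_def M_def
    by (intro mult_left_mono) auto
  finally have "real (card B) \<le> ((1 / \<epsilon>) ^ Suc N * 2 ^ N * (1 - \<epsilon>) ^ T) * card M"
    by (simp only: mult_ac)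
  then have "err_prob q E n N d T R f g \<le> (1 / \<epsilon>) ^ Suc N * 2 ^ N * (1 - \<epsilon>) ^ T"
    unfolding err_prob_def M_def[symmetric] B_def[symmetric]
    using card_msgs_pos[of N T R] unfolding M_def[symmetric] by (subst pos_divide_le_eq) auto
  then show ?thesis by blast
qed

text \<open>Strictness is asked only where the total rate is positive, because a cut of rank zero
  allows no strict bound on a total rate of zero.\<close>

lemma achievable_of_strict_cut_bounds:
  assumes "q \<ge> 1" "d \<notin> {1..N}" "E \<subseteq> insert d {1..N} \<times> insert d {1..N}"
    and "R \<in> rate_tuples N" and R0: "\<And>i. i \<in> {1..N} \<Longrightarrow> 0 \<le> R i"
    and strict: "\<And>A. A \<subseteq> {1..N} \<Longrightarrow> 0 < (\<Sum>i\<in>A. R i) \<Longrightarrow>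
      (\<Sum>i\<in>A. R i) < real (cut_rank q E n (insert d {1..N}) A)"
  shows "achievable q E n N d R"
proof -
  define Q where "Q = {(S, A). S \<noteq> {} \<and> S \<subseteq> A \<and> A \<subseteq> {1..N} \<and> (\<forall>i\<in>S. 0 < R i)}"
  define a :: "nat set \<times> nat set \<Rightarrow> real" where
    "a x = 1 / 2 ^ cut_rank q E n (insert d {1..N}) (snd x)" for x
  define b :: "nat set \<times> nat set \<Rightarrow> real" where "b x = 2 powr - (\<Sum>i\<in>fst x. R i)" for x
  have "finite Q"
    by (rule finite_subset[of _ "Pow {1..N} \<times> Pow {1..N}"]) (auto simp: Q_def)
  moreover have "a x < b x" if "x \<in> Q" for x
  proof -
    obtain S A where x: "x = (S, A)" "S \<noteq> {}" "S \<subseteq> A" "A \<subseteq> {1..N}" "\<forall>i\<in>S. 0 < R i"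
      using \<open>x \<in> Q\<close> by (auto simp: Q_def)
    have finA: "finite A"
      by (rule finite_subset[OF x(4)]) simp
    have finS: "finite S"
      by (rule finite_subset[OF x(3) finA])
    have "0 < (\<Sum>i\<in>S. R i)"
      using x(2,5) finS by (intro sum_pos) auto
    \<comment> \<open>Since rates are nonnegative, the bound for the larger set \<open>A\<close>
      also controls the rate of \<open>S\<close>.\<close>
    moreover have "(\<Sum>i\<in>S. R i) \<le> (\<Sum>i\<in>A. R i)"
      using x(3,4) finA R0 by (intro sum_mono2) auto
    ultimately have "(\<Sum>i\<in>S. R i) < real (cut_rank q E n (insert d {1..N}) A)"
      using strict[OF x(4)] by linarith
    then have "2 powr - real (cut_rank q E n (insert d {1..N}) A) < 2 powr - (\<Sum>i\<in>S. R i)"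
      by (intro powr_less_mono) auto
    then show ?thesis
      by (simp add: a_def b_def x(1) powr_minus powr_realpow inverse_eq_divide)
  qed
  ultimately obtain \<epsilon> where \<epsilon>: "0 < \<epsilon>" "\<epsilon> < 1" "\<forall>x\<in>Q. a x + \<epsilon> \<le> (1 - \<epsilon>) * b x"
    using exists_uniform_margin[of Q a b] by blast
  have "\<exists>f g. err_prob q E n N d T R f g \<le> (1 / \<epsilon>) ^ Suc N * 2 ^ N * (1 - \<epsilon>) ^ T" for T
  proof (rule exists_code_err_prob_le[OF assms(1-3) R0 \<epsilon>(1,2)])
    fix S A assume "S \<noteq> {}" "S \<subseteq> A" "A \<subseteq> {1..N}" "\<And>i. i \<in> S \<Longrightarrow> 0 < R i"
    then have "(S, A) \<in> Q" by (simp add: Q_def)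
    then show "1 / 2 ^ cut_rank q E n (insert d {1..N}) A + \<epsilon> \<le> (1 - \<epsilon>) * 2 powr - (\<Sum>i\<in>S. R i)"
      using bspec[OF \<epsilon>(3)] unfolding a_def b_def by fastforce
  qed
  then obtain f g where fg:
    "err_prob q E n N d T R (f T) (g T) \<le> (1 / \<epsilon>) ^ Suc N * 2 ^ N * (1 - \<epsilon>) ^ T" for T
    by metis
  have "(\<lambda>T. (1 - \<epsilon>) ^ T) \<longlonglongrightarrow> 0"
    by (rule LIMSEQ_power_zero) (use \<epsilon> in auto)
  from tendsto_mult_right_zero[OF this]
  have "(\<lambda>T. (1 / \<epsilon>) ^ Suc N * 2 ^ N * (1 - \<epsilon>) ^ T) \<longlonglongrightarrow> 0" .
  then have "(\<lambda>T. err_prob q E n N d T R (f T) (g T)) \<longlonglongrightarrow> 0"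
  proof (rule tendsto_sandwich[OF _ _ tendsto_const, rotated 2])
    show "\<forall>\<^sub>F T in sequentially. 0 \<le> err_prob q E n N d T R (f T) (g T)"
      by (simp add: err_prob_def)
    show "\<forall>\<^sub>F T in sequentially. err_prob q E n N d T R (f T) (g T)
        \<le> (1 / \<epsilon>) ^ Suc N * 2 ^ N * (1 - \<epsilon>) ^ T"
      using fg by (intro always_eventually allI)
  qed
  then show ?thesis
    using assms(4) R0 unfolding achievable_def by blast
qed

section \<open>Closedness of the region and the capacity theorem\<close>

lemma closed_rate_region:
  "closed {R \<in> rate_tuples N. (\<forall>i\<in>{1..N}. 0 \<le> R i) \<and>
    (\<forall>S. S \<subseteq> {1..N} \<longrightarrow> (\<Sum>i\<in>S. R i) \<le> c S)}"
  unfolding rate_tuples_def mem_Collect_eq Ball_def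
  by (intro closed_Collect_conj closed_Collect_all closed_Collect_imp open_Collect_const
      closed_Collect_eq closed_Collect_le continuous_on_const continuous_on_sum
      continuous_on_product_coordinates)

theorem theorem1:
  fixes q N d :: nat and E :: "(nat \<times> nat) set" and n :: "nat \<times> nat \<Rightarrow> nat"
  assumes "q \<ge> 1"
    and "d \<notin> {1..N}"
    and "E \<subseteq> insert d {1..N} \<times> insert d {1..N}"
    and "acyclic E"
    and "\<forall>e\<in>E. n e \<le> q"
  shows "capacity_region q E n N d =
           {R \<in> rate_tuples N. (\<forall>i\<in>{1..N}. 0 \<le> R i) \<and>
              (\<forall>S. S \<subseteq> {1..N} \<longrightarrow>
                 (\<Sum>i\<in>S. R i) \<le> real (cut_rank q E n (insert d {1..N}) S))}"
    (is "_ = ?C")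
proof
  show "capacity_region q E n N d \<subseteq> ?C"
    unfolding capacity_region_def
  proof (rule closure_minimal[OF _ closed_rate_region], rule subsetI)
    fix R assume "R \<in> {R. achievable q E n N d R}"
    then have "achievable q E n N d R" by simp
    then show "R \<in> ?C"
      using achievable_imp_cut_bound[OF assms(1-3)] unfolding achievable_def by blast
  qed
next
  show "?C \<subseteq> capacity_region q E n N d"
  proof
    fix R assume "R \<in> ?C"
    then have R: "R \<in> rate_tuples N" "\<And>i. i \<in> {1..N} \<Longrightarrow> 0 \<le> R i"
      "\<And>S. S \<subseteq> {1..N} \<Longrightarrow> (\<Sum>i\<in>S. R i) \<le> real (cut_rank q E n (insert d {1..N}) S)"
      by auto
    \<comment> \<open>Scaling by \<open>s < 1\<close> makes every bound with positive total rate
      strict. The original tuple \<open>scale 1\<close> is then reached by continuity, as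
      \<open>1\<close> lies in the closure of the open unit interval.\<close>
    define scale where "scale s = (\<lambda>i. s * R i)" for s :: real
    have "scale s \<in> {R. achievable q E n N d R}" if "s \<in> {0<..<1}" for s
    proof (rule CollectI, rule achievable_of_strict_cut_bounds[OF assms(1-3)])
      show "scale s \<in> rate_tuples N"
        using R(1) by (auto simp: rate_tuples_def scale_def)
      show "0 \<le> scale s i" if "i \<in> {1..N}" for i
        using R(2)[OF that] \<open>s \<in> {0<..<1}\<close> by (simp add: scale_def)
      show "(\<Sum>i\<in>A. scale s i) < real (cut_rank q E n (insert d {1..N}) A)"
        if A: "A \<subseteq> {1..N}" and pos: "0 < (\<Sum>i\<in>A. scale s i)" for A
      proof -
        have sum: "(\<Sum>i\<in>A. scale s i) = s * (\<Sum>i\<in>A. R i)"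
          by (simp add: scale_def sum_distrib_left)
        then have "0 < (\<Sum>i\<in>A. R i)"
          using pos \<open>s \<in> {0<..<1}\<close> by (simp add: zero_less_mult_iff)
        then have "s * (\<Sum>i\<in>A. R i) < 1 * (\<Sum>i\<in>A. R i)"
          using \<open>s \<in> {0<..<1}\<close> by (intro mult_strict_right_mono) auto
        then show ?thesis
          using R(3)[OF A] sum by linarith
      qed
    qed
    then have "scale ` {0<..<1} \<subseteq> capacity_region q E n N d"
      unfolding capacity_region_def using closure_subset by blast
    moreover have "continuous_on (closure {0<..<1}) scale"
      unfolding scale_def
      by (intro continuous_on_coordinatewise_then_product continuous_intros)
    ultimately have "scale ` closure {0<..<1} \<subseteq> capacity_region q E n N d"
      by (intro image_closure_subset) (auto simp: capacity_region_def)
    moreover have "R = scale 1" "1 \<in> closure {0<..<1 :: real}"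
      by (auto simp: scale_def)
    ultimately show "R \<in> capacity_region q E n N d"
      by blast
  qed
qed

end
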